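(* Consider a PD-$f$ MANET, with local-queue process $\{\mathbf X(t)\}$, per-slot probabilities $p_0,p_1,p_2$, packet generating probability $\lambda$, buffer size $M\ge 1$, dispatch limit $f\ge 1$ and conditional steady state distribution $\boldsymbol{\pi}^{*}_{\Omega}=[\pi^{*}_{\Omega,0}\ \boldsymbol{\pi}^{*}_{\Omega,1}\cdots\boldsymbol{\pi}^{*}_{\Omega,M}]$ as defined in the context. Let $U$ be the (steady-state) source delay of a packet. Then the probability mass function, CDF, mean $\overline{U}$ and variance $\sigma_U^2$ of $U$ are given by $$\Pr\{U=u\}=\boldsymbol{\pi}^{-}_{\Omega}\mathbf{T}^{u-1}\mathbf{c}^{+},\quad u\ge 1,$$ $$\Pr\{U\le u\}=1-\boldsymbol{\pi}^{-}_{\Omega}\mathbf{T}^{u}\mathbf{1},\quad u\ge 0,$$ $$\overline{U}=\boldsymbol{\pi}^{-}_{\Omega}(\mathbf{I}-\mathbf{T})^{-2}\mathbf{c}^{+},$$ $$\sigma_U^2=\boldsymbol{\pi}^{-}_{\Omega}(\mathbf{I}+\mathbf{T})(\mathbf{I}-\mathbf{T})^{-3}\mathbf{c}^{+}-\overline{U}^2,$$ where $\mathbf 1$ is the all-ones column vector, $\mathbf I$ is the identity matrix of size $(Mf)\times(Mf)$, $\boldsymbol{\pi}^{-}_{\Omega}=[\boldsymbol{\pi}^{*}_{\Omega,1}\ \boldsymbol{\pi}^{*}_{\Omega,2}\cdots\boldsymbol{\pi}^{*}_{\Omega,M}]$ is the row vector of size $Mf$ obtained from $\boldsymbol{\pi}^{*}_{\Omega}$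 by deleting its first entry, and the column vector $\mathbf c^{+}$ of size $Mf$ and the $(Mf)\times(Mf)$ matrix $\mathbf T$ are as follows. Let $\mathbf c=[p_0\ \cdots\ p_0\ \ p_0+p_1]^T$ (column vector of size $f$; $\mathbf c=[p_0+p_1]$ if $f=1$), $\mathbf r=[1\ 0\ \cdots\ 0]$ (row vector of size $f$), and let $\mathbf Q$ be the $f\times f$ matrix with all diagonal entries $p_2$, all entries immediately above the diagonal $p_1$, and all other entries $0$. For $M=1$: $\mathbf c^{+}=\mathbf c$ and $\mathbf T=\mathbf Q$. For $M\ge 2$: $\mathbf c^{+}=[\mathbf c^T\ 0\ \cdots\ 0]^T$, and $\mathbf T$ is the $M\times M$ block tridiagonal matrix with $f\times f$ blocks $$\mathbf T=\begin{bmatrix}\mathbf{A_1}&\mathbf{A_0}&&&\\ \mathbf{A_2}&\mathbf{A_1}&\mathbf{A_0}&&\\ &\ddots&\ddots&\ddots&\\ &&\mathbf{A_2}&\mathbf{A_1}&\mathbf{A_0}\\ &&&\mathbf{A_2}&\mathbf{A_M}\end{bmatrix},\qquad \mathbf{A_0}=\mathbf 0,\ \ \mathbf{A_1}=\mathbf Q,\ \ \mathbf{A_2}=\mathbf c\cdot\mathbf r,\ \ \mathbf{A_M}=\mathbf Q.$$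
   Context: Network. Time is slotted. A torus MANET of unit area is partitioned into $m\times m$ equal cells ($m\ge 3$), with $n\ge 2$ mobile nodes. At the start of each slot every node moves, independently of everything else, to a uniformly random cell and stays there during the slot (IID mobility). Each node is the source of one traffic flow and the destination of another one. A node's transmission range covers its own cell and the 8 neighboring cells (range $r=\sqrt8/m$). Let $\Delta\ge 0$ be the guard factor and $\alpha=\min\{\lceil(1+\Delta)\sqrt8+2\rceil,m\}$. Cells are divided into $\alpha^2$ equivalence classes (cells whose horizontal and vertical separations are multiples of $\alpha$), activated alternately slot by slot. In each active cell one of the nodes present is chosen uniformly at random to access the channel. PD-$f$ scheme. Fix $f\ge 1$ and $0<q<1$. A source node $S$ with destination $D$ has a first-come-first-served local-queue with buffer size $M\ge 1$. In each slot in which $S$ has accessed the channel and its queue is nonempty: if $D$ is in $S$'s range, $S$ transmits the head-of-line (HoL) packet to $D$ and removes it from the queue (source-destination transmission); otherwise, with probability $q$, $S$ dispatches the HoL packet once (packet-dispatch transmission), and removes it from the queue if it has then been dispatched $f$ times. Per-slot probabilities. In each slot, $p_0$ (resp. $p_1$, $p_2$) is the probability that $S$ has an opportunity for a source-destination transmission (resp. a packet-dispatch transmission, resp. neither); namely $$p_0=\frac1{\alpha^2}\Big\{\frac{9n-m^2}{n(n-1)}-\Big(\frac{m^2-1}{m^2}\Big)^{n-1}\frac{8n+1-m^2}{n(n-1)}\Big\},\quad p_1=\frac{q(m^2-9)}{\alpha^2(n-1)}\Big\{1-\Big(\frac{m^2-1}{m^2}\Big)^{n-1}\Big\},\quad p_2=1-p_0-p_1.$$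 These outcomes are independent across slots. Independently of them, $S$ generates a packet in each slot with probability $\lambda$ ($0<\lambda<1$), independently across slots. Queue dynamics. $\mathbf X(t)=(L(t),J(t))$ is the state at the beginning of slot $t$: $L(t)\in\{0,\dots,M\}$ is the number of packets in the queue and $J(t)\in\{0,\dots,f-1\}$ is the number of dispatches already made for the HoL packet ($J(t)=0$ if $L(t)=0$). During slot $t$, first the transmission outcome is applied to the HoL packet present at the beginning of the slot (if $L(t)\ge1$): with probability $p_0$ it is removed; with probability $p_1$ it is dispatched ($J$ increases by 1, and if $J(t)=f-1$ it is removed); with probability $p_2$ nothing happens; after a removal, $J$ is reset to $0$. Then, if a packet is generated in the slot, it is appended to the queue if after this step the queue has fewer than $M$ packets, and it is dropped otherwise. Thus $\{\mathbf X(t)\}$ is a Markov chain on $\{(0,0)\}\cup\{(l,j):1\le l\le M,0\le j\le f-1\}$. States are ordered $(0,0),(1,0),\dots,(1,f-1),(2,0),\dots,(M,f-1)$. Conditional steady state. $\boldsymbol\pi^*_\Omega$ is the row vector of size $1+Mf$ giving the limit, as $t\to\infty$, of the distribution of $\mathbf X(t+1)$ conditioned on the event that a new packet has been inserted into the local-queue in slot $t$. Its entry for $(0,0)$ is $\pi^*_{\Omega,0}$, and $\boldsymbol\pi^*_{\Omega,l}$ is its sub-vector of size $f$ for the states $(l,0),\dots,(l,f-1)$. Source delay. The source delay $U$ of a packet is the time it spends in its local-queue after it is inserted: a packet inserted in slot $t$ and removed from the queue in slot $t+u$ has $U=u$. In steady state, the state $\mathbf X(t+1)$ just after the insertion is distributed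 according to $\boldsymbol\pi^*_\Omega$, with the inserted packet being the last one in the queue. *)

theory Defs
  imports "HOL-Probability.Probability" "Jordan_Normal_Form.Gauss_Jordan_Elimination"
begin

no_notation inner (infix "\<bullet>" 70)
no_notation Finite_Cartesian_Product.vec_nth (infixl "$" 90)
hide_const (open) Finite_Cartesian_Product.vec

subsection \<open>Per-slot probabilities\<close>

text \<open>The factor \<open>\<alpha>\<close>: cells whose separations are multiples of it are active simultaneously.
  The probabilities below are averaged over the \<open>\<alpha>\<^sup>2\<close> classes of cells.\<close>

definition reuse_factor :: "nat \<Rightarrow> real \<Rightarrow> int" where
  "reuse_factor m \<Delta> = min \<lceil>(1 + \<Delta>) * sqrt 8 + 2\<rceil> (int m)"

definition sd_prob :: "nat \<Rightarrow> nat \<Rightarrow> real \<Rightarrow> real" where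
  "sd_prob n m \<Delta> =
     1 / (real_of_int (reuse_factor m \<Delta>))\<^sup>2 *
     ((9 * real n - (real m)\<^sup>2) / (real n * (real n - 1))
      - (((real m)\<^sup>2 - 1) / (real m)\<^sup>2) ^ (n - 1)
        * ((8 * real n + 1 - (real m)\<^sup>2) / (real n * (real n - 1))))"

definition pd_prob :: "nat \<Rightarrow> nat \<Rightarrow> real \<Rightarrow> real \<Rightarrow> real" where
  "pd_prob n m \<Delta> q =
     q * ((real m)\<^sup>2 - 9) / ((real_of_int (reuse_factor m \<Delta>))\<^sup>2 * (real n - 1))
     * (1 - (((real m)\<^sup>2 - 1) / (real m)\<^sup>2) ^ (n - 1))"

subsection \<open>Queue dynamics\<close>

datatype transmission = Source_Dest | Packet_Dispatch | No_Transmission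

text \<open>A state \<open>(l, j)\<close> consists of the number \<open>l\<close> of queued packets and the number \<open>j\<close> of
  dispatches already made for the head-of-line packet. The randomness of one slot is a pair: the
  transmission outcome, and whether a packet is generated.\<close>

type_synonym state = "nat \<times> nat"
type_synonym slot = "transmission \<times> bool"

definition states :: "nat \<Rightarrow> nat \<Rightarrow> state set" where
  "states f M = {(0, 0)} \<union> {1..M} \<times> {0..<f}"

definition departs :: "nat \<Rightarrow> slot \<Rightarrow> state \<Rightarrow> bool" where
  "departs f w s \<longleftrightarrow> fst s \<ge> 1 \<and>
     (fst w = Source_Dest \<or> fst w = Packet_Dispatch \<and> snd s = f - 1)"

definition after_transmission :: "nat \<Rightarrow> slot \<Rightarrow> state \<Rightarrow> state" where
  "after_transmission f w s =
     (if departs f w s then (fst s - 1, 0)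
      else if fst s \<ge> 1 \<and> fst w = Packet_Dispatch then (fst s, snd s + 1)
      else s)"

definition inserts :: "nat \<Rightarrow> nat \<Rightarrow> slot \<Rightarrow> state \<Rightarrow> bool" where
  "inserts f M w s \<longleftrightarrow> snd w \<and> fst (after_transmission f w s) < M"

definition step :: "nat \<Rightarrow> nat \<Rightarrow> slot \<Rightarrow> state \<Rightarrow> state" where
  "step f M w s =
     (let s' = after_transmission f w s
      in if inserts f M w s then (fst s' + 1, snd s') else s')"

definition slot_pmf :: "real \<Rightarrow> real \<Rightarrow> real \<Rightarrow> slot pmf" where
  "slot_pmf p0 p1 lam =
     pair_pmf
       (embed_pmf (\<lambda>x. case x of Source_Dest \<Rightarrow> p0 | Packet_Dispatch \<Rightarrow> p1
                                | No_Transmission \<Rightarrow> 1 - p0 - p1))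
       (bernoulli_pmf lam)"

text \<open>A sample consists of the initial state and the randomness of the slots \<open>0, 1, 2, \<dots>\<close>;
  all of these are independent.\<close>

type_synonym sample = "state \<times> (nat \<Rightarrow> slot)"

definition queue_space :: "real \<Rightarrow> real \<Rightarrow> real \<Rightarrow> state pmf \<Rightarrow> sample measure" where
  "queue_space p0 p1 lam init =
     measure_pmf init \<Otimes>\<^sub>M (\<Pi>\<^sub>M t\<in>UNIV. measure_pmf (slot_pmf p0 p1 lam))"

text \<open>The state at the beginning of slot \<open>t\<close>.\<close>

primrec X :: "nat \<Rightarrow> nat \<Rightarrow> nat \<Rightarrow> sample \<Rightarrow> state" where
  "X f M 0 \<omega> = fst \<omega>"
| "X f M (Suc t) \<omega> = step f M (snd \<omega> t) (X f M t \<omega>)"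

definition inserted_in :: "nat \<Rightarrow> nat \<Rightarrow> nat \<Rightarrow> sample \<Rightarrow> bool" where
  "inserted_in f M t \<omega> \<longleftrightarrow> inserts f M (snd \<omega> t) (X f M t \<omega>)"

definition departs_in :: "nat \<Rightarrow> nat \<Rightarrow> nat \<Rightarrow> sample \<Rightarrow> bool" where
  "departs_in f M t \<omega> \<longleftrightarrow> departs f (snd \<omega> t) (X f M t \<omega>)"

subsection \<open>Conditional steady state\<close>

definition cond_dist ::
    "nat \<Rightarrow> nat \<Rightarrow> real \<Rightarrow> real \<Rightarrow> real \<Rightarrow> state pmf \<Rightarrow> nat \<Rightarrow> state \<Rightarrow> real" where
  "cond_dist f M p0 p1 lam init t s =
     cond_prob (queue_space p0 p1 lam init) (\<lambda>\<omega>. X f M (t + 1) \<omega> = s) (inserted_in f M t)"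

definition cond_steady ::
    "nat \<Rightarrow> nat \<Rightarrow> real \<Rightarrow> real \<Rightarrow> real \<Rightarrow> state pmf \<Rightarrow> state \<Rightarrow> real" where
  "cond_steady f M p0 p1 lam init s = lim (\<lambda>t. cond_dist f M p0 p1 lam init t s)"

text \<open>Enumeration of the states as \<open>(0,0), (1,0), \<dots>, (1,f-1), (2,0), \<dots>, (M,f-1)\<close>.\<close>

definition state_at :: "nat \<Rightarrow> nat \<Rightarrow> state" where
  "state_at f k = (if k = 0 then (0, 0) else ((k - 1) div f + 1, (k - 1) mod f))"

definition cond_steady_vec ::
    "nat \<Rightarrow> nat \<Rightarrow> real \<Rightarrow> real \<Rightarrow> real \<Rightarrow> state pmf \<Rightarrow> real vec" where
  "cond_steady_vec f M p0 p1 lam init =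
     vec (1 + M * f) (\<lambda>k. cond_steady f M p0 p1 lam init (state_at f k))"

definition delete_first :: "'a vec \<Rightarrow> 'a vec" where
  "delete_first v = vec (dim_vec v - 1) (\<lambda>i. v $ (i + 1))"

subsection \<open>Source delay\<close>

text \<open>Steady-state probability space seen by an inserted packet: slot \<open>0\<close> of this space is the
  slot following the insertion, and the state at its beginning has the conditional steady-state
  distribution.\<close>

definition tagged_space ::
    "nat \<Rightarrow> nat \<Rightarrow> real \<Rightarrow> real \<Rightarrow> real \<Rightarrow> state pmf \<Rightarrow> sample measure" where
  "tagged_space f M p0 p1 lam init =
     queue_space p0 p1 lam (embed_pmf (cond_steady f M p0 p1 lam init))"

text \<open>The tagged packet is initially the last of the \<open>fst (X f M 0 \<omega>)\<close> packets in the queue. As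
  the queue is first-come-first-served, it is removed in the slot of the departure bearing that
  number. If it is inserted in slot \<open>-1\<close> and removed in slot \<open>u - 1\<close>, then
  its delay is \<open>u\<close>. If it is never removed, the infimum below is \<open>0\<close>.\<close>

definition source_delay :: "nat \<Rightarrow> nat \<Rightarrow> sample \<Rightarrow> nat" where
  "source_delay f M \<omega> =
     Inf {u. card {i. i < u \<and> departs_in f M i \<omega>} = fst (X f M 0 \<omega>)}"

subsection \<open>The matrices\<close>

definition c_vec :: "nat \<Rightarrow> real \<Rightarrow> real \<Rightarrow> real vec" where
  "c_vec f p0 p1 = vec f (\<lambda>j. if j = f - 1 then p0 + p1 else p0)"

definition r_vec :: "nat \<Rightarrow> real vec" where
  "r_vec f = vec f (\<lambda>j. if j = 0 then 1 else 0)"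

definition Q_mat :: "nat \<Rightarrow> real \<Rightarrow> real \<Rightarrow> real mat" where
  "Q_mat f p1 p2 = mat f f (\<lambda>(i, j). if j = i then p2 else if j = i + 1 then p1 else 0)"

definition A0_mat :: "nat \<Rightarrow> real mat" where
  "A0_mat f = 0\<^sub>m f f"

definition A1_mat :: "nat \<Rightarrow> real \<Rightarrow> real \<Rightarrow> real mat" where
  "A1_mat f p1 p2 = Q_mat f p1 p2"

definition A2_mat :: "nat \<Rightarrow> real \<Rightarrow> real \<Rightarrow> real mat" where
  "A2_mat f p0 p1 = mat_of_cols f [c_vec f p0 p1] * mat_of_rows f [r_vec f]"

definition AM_mat :: "nat \<Rightarrow> real \<Rightarrow> real \<Rightarrow> real mat" where
  "AM_mat f p1 p2 = Q_mat f p1 p2"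

text \<open>Block \<open>(a, b)\<close>, with \<open>a, b < M\<close>, of the block tridiagonal matrix.\<close>

definition T_block :: "nat \<Rightarrow> nat \<Rightarrow> real \<Rightarrow> real \<Rightarrow> real \<Rightarrow> nat \<Rightarrow> nat \<Rightarrow> real mat" where
  "T_block f M p0 p1 p2 a b =
     (if a = b then (if a = M - 1 then AM_mat f p1 p2 else A1_mat f p1 p2)
      else if b = a + 1 then A0_mat f
      else if a = b + 1 then A2_mat f p0 p1
      else 0\<^sub>m f f)"

definition T_mat :: "nat \<Rightarrow> nat \<Rightarrow> real \<Rightarrow> real \<Rightarrow> real \<Rightarrow> real mat" where
  "T_mat f M p0 p1 p2 =
     (if M = 1 then Q_mat f p1 p2
      else mat (M * f) (M * f)
             (\<lambda>(i, j). T_block f M p0 p1 p2 (i div f) (j div f) $$ (i mod f, j mod f)))"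

definition c_plus :: "nat \<Rightarrow> nat \<Rightarrow> real \<Rightarrow> real \<Rightarrow> real vec" where
  "c_plus f M p0 p1 =
     (if M = 1 then c_vec f p0 p1 else c_vec f p0 p1 @\<^sub>v 0\<^sub>v ((M - 1) * f))"

definition ones :: "nat \<Rightarrow> real vec" where
  "ones d = vec d (\<lambda>_. 1)"

end

theory Submission
  imports Defs "Jordan_Normal_Form.Determinant"
begin

text \<open>Conditioning on the first slot turns probabilities of events of the queue into iterates of a
  transition operator on functions of the state. Whatever the initial state, \<open>M\<close> successive slots
  with a source-destination transmission and without a generated packet empty the queue; this has
  probability at least \<open>\<delta> ^ M > 0\<close>, hence the iterates contract the oscillation of a function of the
  state and the conditional steady state exists. A packet inserted last leaves with the departure
  whose number is the initial queue length, and later arrivals do not influence the departures up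
  to that one. So the probability that the delay exceeds \<open>u\<close> satisfies the recursion defining
  \<open>T ^ u 1\<close>. These tails decay geometrically, which makes \<open>I - T\<close> invertible, and the moments
  are \<open>\<Sum> P(U > u)\<close> and \<open>\<Sum> (2 u + 1) P(U > u)\<close>, evaluated by telescoping.\<close>

section \<open>The per-slot probabilities\<close>

text \<open>The steady state is never computed: the formulas use of it only that it is a probability
  law on the states with nonempty queue. Conditioning on an insertion makes it a limit of quotients;
  numerator and denominator converge separately, and \<open>p0 * lam\<close> keeps the denominator
  away from 0, because a slot with a source-destination outcome and a generated packet always
  inserts. This rests on \<open>p0 > 0\<close> and \<open>p2 \<ge> 0\<close>, which the closed forms
  hide, as their terms may be negative. Two decay rates occur. Emptying the queue takes slots
  without arrivals, hence \<open>\<delta> = p0 * (1 - lam)\<close>; arrivals join behind the tagged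
  packet, so its tails are controlled by \<open>p0\<close> alone. The infimum in
  \<open>source_delay\<close> is 0 on runs where the packet never leaves, so these runs must be
  shown null before P(U > u) can be read off the departure count. Finally \<open>c_plus\<close> is
  the vector \<open>1 - T 1\<close>: the mass function is a difference of consecutive tails, and one
  power of the inverse in each moment formula only turns \<open>c_plus\<close> back into the vector
  1.\<close>

lemma reuse_factor_ge_3:
  assumes "m \<ge> 3" "\<Delta> \<ge> 0"
  shows "reuse_factor m \<Delta> \<ge> 3"
proof -
  have "2 \<le> sqrt 8"
    by (rule real_le_rsqrt) simp
  moreover have "0 \<le> \<Delta> * sqrt 8"
    using assms by simp
  ultimately have "3 \<le> (1 + \<Delta>) * sqrt 8 + 2"
    by (simp add: distrib_right)
  then have "3 \<le> \<lceil>(1 + \<Delta>) * sqrt 8 + 2\<rceil>"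
    by linarith
  then show ?thesis
    using assms by (simp add: reuse_factor_def)
qed

text \<open>Up to the factor \<open>1 / \<alpha>\<^sup>2\<close>, the first summand accounts for a destination in one of the
  8 neighbouring cells, the second one for a destination in the cell of the source.\<close>

lemma sd_prob_decomposition:
  assumes "n \<ge> 2" "m \<ge> 1"
  defines "x \<equiv> ((real m)\<^sup>2 - 1) / (real m)\<^sup>2"
  shows "sd_prob n m \<Delta> = 1 / (real_of_int (reuse_factor m \<Delta>))\<^sup>2 *
    (8 * (1 - x ^ (n - 1)) / (real n - 1)
      + (real n - (real m)\<^sup>2 * (1 - x ^ n)) / (real n * (real n - 1)))"
proof -
  define y where "y = x ^ (n - 1)"
  have "x ^ n = x * y"
    using assms(1) by (cases n) (simp_all add: y_def)
  moreover have "(real m)\<^sup>2 * x = (real m)\<^sup>2 - 1"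
    using assms(2) by (simp add: x_def)
  ultimately have *: "(real m)\<^sup>2 * (1 - x ^ n) = (real m)\<^sup>2 - ((real m)\<^sup>2 - 1) * y"
    by (simp add: right_diff_distrib mult.assoc[symmetric])
  show ?thesis
    using assms(1) unfolding sd_prob_def x_def[symmetric] y_def[symmetric] *
    by (simp add: divide_simps) (simp add: algebra_simps)
qed

text \<open>In the decomposed form of \<open>sd_prob\<close> both summands are visibly nonnegative.
  For the sum, \<open>q\<close> is replaced by 1; what remains is \<open>y / n\<close>, the chance
  that a given node is the one chosen in its cell, divided by \<alpha> squared, which is at least
  9.\<close>

lemma slot_prob_bounds:
  assumes "n \<ge> 2" "m \<ge> 3" "\<Delta> \<ge> 0" "0 < q" "q < 1"
  shows "0 < sd_prob n m \<Delta>" "0 \<le> pd_prob n m \<Delta> q"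
    and "sd_prob n m \<Delta> + pd_prob n m \<Delta> q < 1"
proof -
  define N where "N = (real m)\<^sup>2"
  define a where "a = (real_of_int (reuse_factor m \<Delta>))\<^sup>2"
  define x where "x = (N - 1) / N"
  have N: "N \<ge> 9"
    using power_mono[of 3 "real m" 2] assms(2) by (simp add: N_def)
  have a: "a \<ge> 9"
    using power_mono[of 3 "real_of_int (reuse_factor m \<Delta>)" 2] reuse_factor_ge_3[OF assms(2,3)]
    by (simp add: a_def)
  have x: "0 < x" "x < 1" "N * x = N - 1"
    using N by (auto simp: x_def)
  define z where "z = 1 - x ^ (n - 1)"
  \<comment> \<open>The expected number of nonempty cells; this is why \<open>y \<le> n\<close>,
    which follows from Bernoulli's inequality.\<close>
  define y where "y = N * (1 - x ^ n)"
  have z: "0 < z" "z < 1"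
    using x power_Suc_less_one[of x "n - 2"] assms(1) by (auto simp: z_def numeral_2_eq_2 Suc_diff_Suc)
  have "1 - real n / N \<le> x ^ n"
    using Bernoulli_inequality[of "- 1 / N" n] N by (simp add: x_def diff_divide_distrib)
  then have "N * (1 - x ^ n) \<le> N * (real n / N)"
    using N by (intro mult_left_mono) auto
  then have y_le: "y \<le> real n"
    using N by (simp add: y_def)
  have "x ^ n = x * x ^ (n - 1)"
    using assms(1) by (cases n) simp_all
  then have yz: "(N - 1) * z = y - 1"
    using x(3) by (simp add: y_def z_def right_diff_distrib mult.assoc[symmetric])
  have p0: "sd_prob n m \<Delta> = 1 / a * (8 * z / (real n - 1) + (real n - y) / (real n * (real n - 1)))"
    using sd_prob_decomposition[of n m \<Delta>] assms(1,2)
    by (simp add: a_def z_def y_def x_def N_def)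
  have p1: "pd_prob n m \<Delta> q = 1 / a * (q * (N - 9) * z / (real n - 1))"
    by (simp add: pd_prob_def a_def z_def x_def N_def)
  have n: "real n - 1 > 0" "real n > 0"
    using assms(1) by auto
  show "0 < sd_prob n m \<Delta>"
    unfolding p0 using a z n y_le by (intro mult_pos_pos add_pos_nonneg) auto
  show "0 \<le> pd_prob n m \<Delta> q"
    unfolding p1 using a z n N assms(4) by simp
  have "q * ((N - 9) * z) \<le> (N - 9) * z"
    using mult_right_mono[of q 1 "(N - 9) * z"] assms(4,5) N z by simp
  then have "8 * z + q * (N - 9) * z \<le> (N - 1) * z"
    by (simp add: algebra_simps)
  then have "(8 * z + q * (N - 9) * z) / (real n - 1) + (real n - y) / (real n * (real n - 1))
      \<le> (y - 1) / (real n - 1) + (real n - y) / (real n * (real n - 1))"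
    using n by (intro add_right_mono divide_right_mono) (auto simp: yz)
  also have "\<dots> = y / real n"
  proof -
    have "(y - 1) / (real n - 1) = real n * (y - 1) / (real n * (real n - 1))"
      using n by simp
    then have "(y - 1) / (real n - 1) + (real n - y) / (real n * (real n - 1))
        = (real n * (y - 1) + (real n - y)) / (real n * (real n - 1))"
      by (simp add: add_divide_distrib)
    also have "real n * (y - 1) + (real n - y) = y * (real n - 1)"
      by (simp add: algebra_simps)
    finally show ?thesis
      using n by simp
  qed
  also have "\<dots> \<le> 1"
    using y_le n by simp
  finally have "1 / a * ((8 * z + q * (N - 9) * z) / (real n - 1)
      + (real n - y) / (real n * (real n - 1))) \<le> 1 / a * 1"
    using a by (intro mult_left_mono) auto
  then have "sd_prob n m \<Delta> + pd_prob n m \<Delta> q \<le> 1 / a"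
    by (simp add: p0 p1 add_divide_distrib distrib_left)
  also have "\<dots> < 1"
    using a by simp
  finally show "sd_prob n m \<Delta> + pd_prob n m \<Delta> q < 1" .
qed

section \<open>The queue started in a fixed state\<close>

instance transmission :: countable
  by countable_datatype

lemma UNIV_transmission: "UNIV = {Source_Dest, Packet_Dispatch, No_Transmission}"
  using transmission.exhaust by auto

lemma UNIV_slot: "(UNIV :: slot set) = {Source_Dest, Packet_Dispatch, No_Transmission} \<times> {True, False}"
  by (simp add: UNIV_Times_UNIV[symmetric] UNIV_transmission UNIV_bool insert_commute del: UNIV_Times_UNIV)

lemma finite_UNIV_slot: "finite (UNIV :: slot set)"
  by (simp add: UNIV_slot)

text \<open>\<open>p1\<close> may vanish: for m = 3 the transmission range covers the whole torus.
  \<open>p0\<close> must be positive, since all decay estimates rest on it.\<close>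

locale pd_queue =
  fixes f M :: nat and p0 p1 lam :: real
  assumes f: "f \<ge> 1" and M: "M \<ge> 1"
    and p0: "0 < p0" and p1: "0 \<le> p1" and p01: "p0 + p1 < 1"
    and lam: "0 < lam" "lam < 1"
begin

abbreviation slots :: "slot pmf" where
  "slots \<equiv> slot_pmf p0 p1 lam"

abbreviation noise :: "(nat \<Rightarrow> slot) measure" where
  "noise \<equiv> \<Pi>\<^sub>M t\<in>UNIV. measure_pmf slots"

lemma pmf_slots:
  "pmf slots (x, b) =
    (case x of Source_Dest \<Rightarrow> p0 | Packet_Dispatch \<Rightarrow> p1 | No_Transmission \<Rightarrow> 1 - p0 - p1)
    * (if b then lam else 1 - lam)"
proof -
  have "(\<integral>\<^sup>+ x. ennreal (case x of Source_Dest \<Rightarrow> p0 | Packet_Dispatch \<Rightarrow> p1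
      | No_Transmission \<Rightarrow> 1 - p0 - p1) \<partial>count_space UNIV) = 1"
    using p0 p1 p01
    by (subst nn_integral_count_space_finite)
      (simp_all add: UNIV_transmission ennreal_plus[symmetric] del: ennreal_plus)
  then show ?thesis
    unfolding slot_pmf_def pmf_pair
    using p0 p1 p01 lam by (subst pmf_embed_pmf) (auto split: transmission.split)
qed

lemma expectation_slots:
  "measure_pmf.expectation slots h =
     p0 * (lam * h (Source_Dest, True) + (1 - lam) * h (Source_Dest, False))
     + p1 * (lam * h (Packet_Dispatch, True) + (1 - lam) * h (Packet_Dispatch, False))
     + (1 - p0 - p1) * (lam * h (No_Transmission, True) + (1 - lam) * h (No_Transmission, False))"
  for h :: "slot \<Rightarrow> real"
  by (subst integral_measure_pmf[OF finite_UNIV_slot], simp)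
    (simp add: UNIV_slot pmf_slots algebra_simps)

lemma integrable_slots [simp]: "integrable (measure_pmf slots) h" for h :: "slot \<Rightarrow> real"
  by (rule integrable_measure_pmf_finite) (rule finite_subset[OF subset_UNIV finite_UNIV_slot])

lemma step_in_states:
  assumes "s \<in> states f M"
  shows "step f M w s \<in> states f M"
  using assms f M
  by (cases s) (auto simp: states_def step_def inserts_def after_transmission_def departs_def Let_def)

section \<open>The product space and conditioning on the first slot\<close>

lemma prob_space_noise: "prob_space noise"
  by (rule prob_space_PiM) (rule prob_space_measure_pmf)

lemma space_noise [simp]: "space noise = UNIV"
  by (simp add: space_PiM)

lemma space_queue_space [simp]: "space (queue_space p0 p1 lam init) = UNIV"
  by (simp add: queue_space_def space_pair_measure)

lemma measurable_slot [measurable]: "(\<lambda>\<omega>. \<omega> t) \<in> measurable noise (count_space UNIV)"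
  by (rule measurable_compose[OF measurable_component_singleton[of t]]) auto

lemma measurable_X [measurable]: "X f M t \<in> measurable (queue_space p0 p1 lam init) (count_space UNIV)"
proof (induction t)
  case 0
  have "fst \<in> measurable (queue_space p0 p1 lam init) (count_space UNIV)"
    unfolding queue_space_def by measurable
  then show ?case by (simp add: fun_eq_iff cong: measurable_cong)
next
  case (Suc t)
  have *: "(\<lambda>\<omega>. snd \<omega> t) \<in> measurable (queue_space p0 p1 lam init) (count_space UNIV)"
    unfolding queue_space_def by measurable
  show ?case
    unfolding X.simps
    by (rule measurable_compose_countable[OF _ *]) (rule measurable_compose[OF Suc], simp)
qed

lemma measurable_slot' [measurable]:
  "(\<lambda>\<omega>. snd \<omega> t) \<in> measurable (queue_space p0 p1 lam init) (count_space UNIV)"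
  unfolding queue_space_def by measurable

lemma measurable_X_slot [measurable]:
  "Measurable.pred (queue_space p0 p1 lam init) (\<lambda>\<omega>. Q (X f M t \<omega>) (snd \<omega> t))"
  by (rule measurable_compose_countable[OF _ measurable_slot'[of t]])
    (rule measurable_compose[OF measurable_X], simp)

lemma measurable_pred_departs_in [measurable]:
  "Measurable.pred (queue_space p0 p1 lam init) (departs_in f M t)"
  using measurable_X_slot[where Q="\<lambda>s w. departs f w s"] by (simp add: departs_in_def[abs_def])

lemma measurable_section:
  assumes "Measurable.pred (queue_space p0 p1 lam init) F"
  shows "Measurable.pred noise (\<lambda>\<omega>. F (s, \<omega>))"
proof -
  have "Pair s \<in> measurable noise (queue_space p0 p1 lam init)"
    unfolding queue_space_def by measurable
  then show ?thesis
    using assms by (rule measurable_compose)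
qed

lemma measure_queue_space:
  assumes "Measurable.pred (queue_space p0 p1 lam init) F"
  shows "measure (queue_space p0 p1 lam init) {\<omega>. F \<omega>} =
    measure_pmf.expectation init (\<lambda>s. measure noise {\<omega>. F (s, \<omega>)})"
proof -
  interpret N: prob_space noise by (rule prob_space_noise)
  interpret NI: pair_prob_space init noise ..
  have F: "{\<omega>. F \<omega>} \<in> sets (queue_space p0 p1 lam init)"
    using assms by (simp add: pred_def)
  have "ennreal (measure (queue_space p0 p1 lam init) {\<omega>. F \<omega>})
      = (\<integral>\<^sup>+ s. emeasure noise (Pair s -` {\<omega>. F \<omega>}) \<partial>init)"
    using F unfolding queue_space_def
    by (subst N.emeasure_pair_measure_alt[symmetric]) (simp_all add: NI.P.emeasure_eq_measure)
  also have "\<dots> = (\<integral>\<^sup>+ s. ennreal (measure noise {\<omega>. F (s, \<omega>)}) \<partial>init)"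
    by (simp add: N.emeasure_eq_measure vimage_def)
  also have "\<dots> = ennreal (measure_pmf.expectation init (\<lambda>s. measure noise {\<omega>. F (s, \<omega>)}))"
    by (rule nn_integral_eq_integral) (auto intro!: measure_pmf.integrable_const_bound[where B=1])
  finally show ?thesis
    by (subst (asm) ennreal_inj) (auto intro!: integral_nonneg)
qed

text \<open>An i.i.d. sequence has the law of an independent slot put in front of such a sequence
  (\<open>PiM_iter\<close>). Together with \<open>X_case_nat\<close> this takes the place of the
  Markov property.\<close>

lemma measure_noise_first_slot:
  assumes "Measurable.pred noise F"
  shows "measure noise {\<omega>. F \<omega>} =
    measure_pmf.expectation slots (\<lambda>w. measure noise {\<omega>. F (case_nat w \<omega>)})"
proof -
  interpret sequence_space "measure_pmf slots"
    by unfold_locales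
  interpret NI: pair_prob_space "measure_pmf slots" noise ..
  have em: "emeasure noise A = ennreal (measure noise A)" for A
    by (rule finite_measure.emeasure_eq_measure[OF prob_space.finite_measure[OF prob_space_noise]])
  have F: "{\<omega>. F \<omega>} \<in> sets noise"
    using assms by (simp add: pred_def)
  have [measurable]: "(\<lambda>(w, \<omega>). case_nat w \<omega>) \<in> measurable (measure_pmf slots \<Otimes>\<^sub>M noise) noise"
    by measurable
  have "emeasure noise {\<omega>. F \<omega>} = emeasure (distr (measure_pmf slots \<Otimes>\<^sub>M noise) noise (\<lambda>(w, \<omega>). case_nat w \<omega>)) {\<omega>. F \<omega>}"
    by (simp add: PiM_iter)
  also have "\<dots> = emeasure (measure_pmf slots \<Otimes>\<^sub>M noise) ((\<lambda>(w, \<omega>). case_nat w \<omega>) -` {\<omega>. F \<omega>} \<inter> space (measure_pmf slots \<Otimes>\<^sub>M noise))"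
    using F by (subst emeasure_distr) simp_all
  also have "\<dots> = (\<integral>\<^sup>+ w. emeasure noise (Pair w -` ((\<lambda>(w, \<omega>). case_nat w \<omega>) -` {\<omega>. F \<omega>} \<inter> space (measure_pmf slots \<Otimes>\<^sub>M noise))) \<partial>slots)"
    by (intro sigma_finite_measure.emeasure_pair_measure_alt prob_space_imp_sigma_finite
        prob_space_noise measurable_sets[OF _ F]) measurable
  also have "\<dots> = (\<integral>\<^sup>+ w. ennreal (measure noise {\<omega>. F (case_nat w \<omega>)}) \<partial>slots)"
    by (simp add: em vimage_def space_pair_measure)
  also have "\<dots> = ennreal (measure_pmf.expectation slots (\<lambda>w. measure noise {\<omega>. F (case_nat w \<omega>)}))"
    by (rule nn_integral_eq_integral) auto
  finally show ?thesis
    unfolding em by (subst (asm) ennreal_inj) (auto intro!: integral_nonneg)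
qed

lemma X_case_nat: "X f M (Suc t) (s, case_nat w \<omega>) = X f M t (step f M w s, \<omega>)"
  by (induction t) simp_all

definition K :: "(state \<Rightarrow> real) \<Rightarrow> state \<Rightarrow> real" where
  "K g s = measure_pmf.expectation slots (\<lambda>w. g (step f M w s))"

text \<open>The first t slots are peeled off one by one, each giving one application of
  \<open>K\<close>; slot t itself is independent of the state at its beginning and is integrated out
  in the innermost function.\<close>

lemma measure_noise_X_slot:
  "measure noise {\<omega>. Q (X f M t (s, \<omega>)) (\<omega> t)} =
    (K ^^ t) (\<lambda>s'. measure slots {w. Q s' w}) s"
proof (induction t arbitrary: s)
  case 0
  interpret N: prob_space noise by (rule prob_space_noise)
  have [measurable]: "Measurable.pred noise (\<lambda>\<omega>. Q s (\<omega> 0))"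
    by (rule measurable_compose[OF measurable_slot]) simp
  \<comment> \<open>Once the slot is fixed the event is everything or nothing, so its measure is an
    indicator.\<close>
  have "measure noise {\<omega>. Q s w} = indicator {w. Q s w} w" for w
    using N.prob_space by (auto simp: indicator_def)
  then show ?case
    by (simp add: measure_noise_first_slot)
next
  case (Suc t)
  have *: "Measurable.pred noise (\<lambda>\<omega>. Q (X f M (Suc t) (s, \<omega>)) (\<omega> (Suc t)))"
    using measurable_section[OF measurable_X_slot[of Q "Suc t"]] by (simp only: snd_conv)
  have "measure noise {\<omega>. Q (X f M (Suc t) (s, \<omega>)) (\<omega> (Suc t))}
      = measure_pmf.expectation slots (\<lambda>w. measure noise {\<omega>. Q (X f M t (step f M w s, \<omega>)) (\<omega> t)})"
    by (subst measure_noise_first_slot[OF *]) (simp only: X_case_nat nat.case)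
  then show ?case
    by (simp add: Suc K_def)
qed

end

section \<open>The conditional steady state\<close>

context pd_queue
begin

text \<open>Lower bounds applied to \<open>-g\<close> give the matching upper bounds, so only lower
  bounds are proved directly.\<close>

lemma K_pow_uminus: "(K ^^ t) (\<lambda>s. - g s) s = - (K ^^ t) g s"
  by (induction t arbitrary: s) (simp_all add: K_def)

lemma K_sum: "K (\<lambda>s. \<Sum>x\<in>A. g x s) s = (\<Sum>x\<in>A. K (g x) s)"
  by (simp add: K_def)

lemma K_pow_sum: "(K ^^ t) (\<lambda>s. \<Sum>x\<in>A. g x s) s = (\<Sum>x\<in>A. (K ^^ t) (g x) s)"
proof (induction t arbitrary: s)
  case (Suc t)
  then have "(K ^^ t) (\<lambda>s. \<Sum>x\<in>A. g x s) = (\<lambda>s. \<Sum>x\<in>A. (K ^^ t) (g x) s)"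
    by auto
  then show ?case
    by (simp add: K_sum)
qed simp

lemma K_pow_cong:
  assumes "\<And>s. s \<in> states f M \<Longrightarrow> g s = h s" "s \<in> states f M"
  shows "(K ^^ t) g s = (K ^^ t) h s"
  using assms(2) by (induction t arbitrary: s) (simp_all add: assms(1) K_def step_in_states)

lemma K_pow_ge:
  assumes "\<And>s. s \<in> states f M \<Longrightarrow> a \<le> g s" "s \<in> states f M"
  shows "a \<le> (K ^^ t) g s"
  using assms(2)
proof (induction t arbitrary: s)
  case (Suc t)
  then show ?case
    by (simp add: K_def) (rule measure_pmf.integral_ge_const, auto simp: step_in_states)
qed (simp add: assms(1))

lemma K_pow_le:
  assumes "\<And>s. s \<in> states f M \<Longrightarrow> g s \<le> b" "s \<in> states f M"
  shows "(K ^^ t) g s \<le> b"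
  using K_pow_ge[of "- b" "\<lambda>s. - g s" s t] assms by (simp add: K_pow_uminus)

text \<open>The probability of a slot with a source-destination transmission and no generated packet.
  A queue that sees \<open>M\<close> such slots in a row is empty afterwards, whatever its initial state.\<close>

definition \<delta> :: real where
  "\<delta> = p0 * (1 - lam)"

lemma \<delta>: "0 < \<delta>" "\<delta> < 1"
  using p0 p1 p01 lam mult_strict_mono[of p0 1 "1 - lam" 1] by (auto simp: \<delta>_def)

text \<open>The excess of \<open>h\<close> over \<open>a\<close> is nonnegative in every outcome of
  the slot, so its mean is at least the contribution of the draining outcome.\<close>

lemma K_ge_drain:
  assumes "\<And>w. a \<le> h (step f M w s)"
  shows "\<delta> * (h (step f M (Source_Dest, False) s) - a) + a \<le> K h s"
proof -
  define d where "d w = h (step f M w s) - a" for w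
  have d: "d w \<ge> 0" for w
    using assms by (simp add: d_def)
  have "K h s - a = measure_pmf.expectation slots d"
    by (simp add: K_def d_def[abs_def] measure_pmf.prob_space)
  moreover have "\<delta> * d (Source_Dest, False) \<le> measure_pmf.expectation slots d"
    unfolding expectation_slots \<delta>_def
    using p0 p1 p01 lam by (simp add: d distrib_left mult.assoc)
  ultimately show ?thesis
    by (simp add: d_def)
qed

text \<open>A draining slot leaves an empty queue empty. Hence \<open>k\<close> may exceed the queue
  length, and \<open>k = M\<close> serves all states at once.\<close>

lemma K_pow_ge_drain:
  assumes "\<And>s. s \<in> states f M \<Longrightarrow> a \<le> g s" "s \<in> states f M" "fst s \<le> k"
  shows "\<delta> ^ k * (g (0, 0) - a) + a \<le> (K ^^ k) g s"
  using assms(2,3)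
proof (induction k arbitrary: s)
  case 0
  then show ?case
    by (auto simp: states_def)
next
  case (Suc k)
  let ?s = "step f M (Source_Dest, False) s"
  have "?s \<in> states f M" "fst ?s \<le> k"
    using Suc.prems step_in_states
    by (auto simp: step_def after_transmission_def departs_def inserts_def states_def)
  then have "\<delta> * (\<delta> ^ k * (g (0, 0) - a)) \<le> \<delta> * ((K ^^ k) g ?s - a)"
    using Suc.IH[of ?s] \<delta> by (intro mult_left_mono) auto
  also have "\<dots> + a \<le> K ((K ^^ k) g) s"
    by (rule K_ge_drain) (use K_pow_ge assms(1) step_in_states Suc.prems in blast)
  finally show ?case
    by (simp add: mult.assoc)
qed

lemma K_pow_contracts:
  assumes "\<And>s. s \<in> states f M \<Longrightarrow> g s \<in> {a..b}"
  shows "\<exists>a' b'. b' - a' = (1 - \<delta> ^ M) * (b - a) \<and> (\<forall>s\<in>states f M. (K ^^ M) g s \<in> {a'..b'})"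
proof (intro exI conjI ballI)
  \<comment> \<open>Both ends of the interval move towards the common value \<open>g (0, 0)\<close>
    by the fraction \<open>\<delta> ^ M\<close>; the upper end is the drain bound for
    \<open>-g\<close>.\<close>
  let ?a = "\<delta> ^ M * (g (0, 0) - a) + a" and ?b = "b - \<delta> ^ M * (b - g (0, 0))"
  show "?b - ?a = (1 - \<delta> ^ M) * (b - a)"
    by (simp add: algebra_simps)
  fix s assume s: "s \<in> states f M"
  then have "fst s \<le> M"
    by (auto simp: states_def)
  then show "(K ^^ M) g s \<in> {?a..?b}"
    using K_pow_ge_drain[of a g s M] K_pow_ge_drain[of "- b" "\<lambda>s. - g s" s M] assms s
    by (simp add: K_pow_uminus)
qed

text \<open>Contraction happens once per M slots, but averaging never leaves an interval, so the
  bound persists for all later t and not only for multiples of M.\<close>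

lemma K_pow_squeeze:
  assumes "\<And>s. s \<in> states f M \<Longrightarrow> g s \<in> {a..b}"
  shows "\<exists>a' b'. b' - a' = (1 - \<delta> ^ M) ^ j * (b - a) \<and>
    (\<forall>t\<ge>j * M. \<forall>s\<in>states f M. (K ^^ t) g s \<in> {a'..b'})"
proof (induction j)
  case 0
  then show ?case
    using assms K_pow_ge[of a g] K_pow_le[of g b]
    by (intro exI[of _ a] exI[of _ b]) auto
next
  case (Suc j)
  then obtain a' b' where ab': "b' - a' = (1 - \<delta> ^ M) ^ j * (b - a)"
    "\<And>s. s \<in> states f M \<Longrightarrow> (K ^^ (j * M)) g s \<in> {a'..b'}"
    by blast
  obtain a'' b'' where ab'': "b'' - a'' = (1 - \<delta> ^ M) * (b' - a')"
    "\<And>s. s \<in> states f M \<Longrightarrow> (K ^^ M) ((K ^^ (j * M)) g) s \<in> {a''..b''}"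
    using K_pow_contracts[of "(K ^^ (j * M)) g", OF ab'(2)] by blast
  have "(K ^^ t) g s \<in> {a''..b''}" if "t \<ge> Suc j * M" "s \<in> states f M" for t s
  proof -
    obtain u where "t = u + (M + j * M)"
      using \<open>t \<ge> Suc j * M\<close> le_Suc_ex by (metis add.commute mult_Suc)
    then have "(K ^^ t) g = (K ^^ u) ((K ^^ M) ((K ^^ (j * M)) g))"
      by (simp add: funpow_add)
    then show ?thesis
      using K_pow_ge[of a'' "(K ^^ M) ((K ^^ (j * M)) g)" s u]
        K_pow_le[of "(K ^^ M) ((K ^^ (j * M)) g)" b'' s u] ab''(2) that by simp
  qed
  then show ?case
    using ab'(1) ab''(1) by (intro exI[of _ a''] exI[of _ b'']) simp
qed

lemma convergent_K_pow:
  assumes "\<And>s. s \<in> states f M \<Longrightarrow> g s \<in> {a..b}" "s \<in> states f M"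
  shows "convergent (\<lambda>t. (K ^^ t) g s)"
proof (rule Cauchy_convergent, rule CauchyI)
  fix e :: real assume "e > 0"
  have ab: "a \<le> b"
    using assms(1)[OF assms(2)] by simp
  have "1 - \<delta> ^ M < 1"
    using \<delta> by simp
  \<comment> \<open>The summand 1 in the denominator covers the degenerate interval
    \<open>a = b\<close>.\<close>
  then obtain j where j: "(1 - \<delta> ^ M) ^ j < e / (b - a + 1)"
    using real_arch_pow_inv[of "e / (b - a + 1)" "1 - \<delta> ^ M"] \<open>e > 0\<close> ab by auto
  have "0 \<le> 1 - \<delta> ^ M"
    using \<delta> by (simp add: power_le_one)
  then have "(1 - \<delta> ^ M) ^ j * (b - a) \<le> (1 - \<delta> ^ M) ^ j * (b - a + 1)"
    by (intro mult_left_mono) auto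
  also have "\<dots> < e"
    using j ab by (simp add: pos_less_divide_eq)
  finally have e: "(1 - \<delta> ^ M) ^ j * (b - a) < e" .
  obtain a' b' where ab': "b' - a' = (1 - \<delta> ^ M) ^ j * (b - a)"
    "\<And>t. t \<ge> j * M \<Longrightarrow> (K ^^ t) g s \<in> {a'..b'}"
    using K_pow_squeeze[of g a b j, OF assms(1)] assms(2) by blast
  show "\<exists>N. \<forall>m\<ge>N. \<forall>n\<ge>N. norm ((K ^^ m) g s - (K ^^ n) g s) < e"
  proof (intro exI allI impI)
    fix m n assume "m \<ge> j * M" "n \<ge> j * M"
    then show "norm ((K ^^ m) g s - (K ^^ n) g s) < e"
      using ab'(2)[of m] ab'(2)[of n] ab'(1) e by (auto simp: abs_if)
  qed
qed

section \<open>Insertions in a single slot\<close>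

definition ins_prob :: "state \<Rightarrow> real" where
  "ins_prob s = measure slots {w. inserts f M w s}"

text \<open>The target comes first, so that \<open>ins_to x\<close> is a function of the current
  state on which \<open>K\<close> can act.\<close>

definition ins_to :: "state \<Rightarrow> state \<Rightarrow> real" where
  "ins_to x s = measure slots {w. step f M w s = x \<and> inserts f M w s}"

text \<open>The support of the law just after an insertion and, once enumerated, the index set of
  \<open>T\<close>.\<close>

definition busy :: "state set" where
  "busy = {1..M} \<times> {0..<f}"

lemma finite_busy [simp]: "finite busy"
  by (simp add: busy_def)

lemma step_in_busy: "s \<in> states f M \<Longrightarrow> inserts f M w s \<Longrightarrow> step f M w s \<in> busy"
  using step_in_states[of s w] by (auto simp: step_def states_def busy_def Let_def)

lemma ins_to_eq_0: "s \<in> states f M \<Longrightarrow> x \<notin> busy \<Longrightarrow> ins_to x s = 0"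
proof -
  assume "s \<in> states f M" "x \<notin> busy"
  then have "{w. step f M w s = x \<and> inserts f M w s} = {}"
    using step_in_busy by blast
  then show ?thesis
    by (simp only: ins_to_def measure_empty)
qed

lemma sum_ins_to:
  assumes "s \<in> states f M"
  shows "(\<Sum>x\<in>busy. ins_to x s) = ins_prob s"
proof -
  have "(\<Sum>x\<in>busy. ins_to x s) =
      measure slots (\<Union>x\<in>busy. {w. step f M w s = x \<and> inserts f M w s})"
    unfolding ins_to_def
    by (rule measure_pmf.finite_measure_finite_Union[symmetric]) (auto simp: disjoint_family_on_def)
  also have "(\<Union>x\<in>busy. {w. step f M w s = x \<and> inserts f M w s}) = {w. inserts f M w s}"
    using step_in_busy[OF assms] by auto
  finally show ?thesis
    by (simp add: ins_prob_def)
qed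

text \<open>With a source-destination outcome a nonempty queue loses a packet and an empty one has
  room because \<open>M \<ge> 1\<close>; either way a generated packet fits. The bound is uniform in
  the state.\<close>

lemma ins_prob_ge:
  assumes "s \<in> states f M"
  shows "p0 * lam \<le> ins_prob s"
proof -
  have "inserts f M (Source_Dest, True) s"
    using assms M by (auto simp: inserts_def after_transmission_def departs_def states_def)
  then have "measure slots {(Source_Dest, True)} \<le> ins_prob s"
    unfolding ins_prob_def by (intro measure_pmf.finite_measure_mono) auto
  then show ?thesis
    by (simp add: measure_pmf_single pmf_slots)
qed

end

section \<open>Existence and total mass of the conditional steady state\<close>

locale pd_queue_from = pd_queue +
  fixes init :: "state pmf"
  assumes init: "set_pmf init \<subseteq> states f M"
begin

definition avg :: "nat \<Rightarrow> (state \<Rightarrow> real) \<Rightarrow> real" where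
  "avg t g = measure_pmf.expectation init ((K ^^ t) g)"

lemma finite_states: "finite (states f M)"
  by (simp add: states_def)

lemma avg_eq_sum: "avg t g = (\<Sum>s\<in>states f M. pmf init s * (K ^^ t) g s)"
  unfolding avg_def using init by (subst integral_measure_pmf[OF finite_states]) auto

lemma avg_sum: "avg t (\<lambda>s. \<Sum>x\<in>A. g x s) = (\<Sum>x\<in>A. avg t (g x))"
  unfolding avg_eq_sum K_pow_sum sum_distrib_left by (rule sum.swap)

lemma avg_cong: "(\<And>s. s \<in> states f M \<Longrightarrow> g s = h s) \<Longrightarrow> avg t g = avg t h"
  unfolding avg_eq_sum by (intro sum.cong refl arg_cong2[where f="(*)"] K_pow_cong)

lemma avg_ge:
  assumes "\<And>s. s \<in> states f M \<Longrightarrow> a \<le> g s"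
  shows "a \<le> avg t g"
  unfolding avg_def
  using init K_pow_ge[of a g, OF assms]
  by (intro measure_pmf.integral_ge_const integrable_measure_pmf_finite)
    (auto intro: finite_subset[OF init finite_states] simp: AE_measure_pmf_iff)

lemma convergent_avg:
  assumes "\<And>s. s \<in> states f M \<Longrightarrow> g s \<in> {a..b}"
  shows "convergent (\<lambda>t. avg t g)"
  unfolding avg_eq_sum
  using convergent_K_pow[of g a b, OF assms]
  by (intro convergent_sum convergent_mult convergent_const)

lemma measure_X_slot:
  "measure (queue_space p0 p1 lam init) {\<omega>. Q (X f M t \<omega>) (snd \<omega> t)} =
    avg t (\<lambda>s. measure slots {w. Q s w})"
  using measurable_X_slot[of Q t init]
  by (simp add: measure_queue_space measure_noise_X_slot[where Q=Q] avg_def)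

lemma cond_dist_eq: "cond_dist f M p0 p1 lam init t x = avg t (ins_to x) / avg t ins_prob"
  using measure_X_slot[of "\<lambda>s w. step f M w s = x \<and> inserts f M w s" t]
    measure_X_slot[of "\<lambda>s w. inserts f M w s" t]
  by (simp add: cond_dist_def cond_prob_def inserted_in_def ins_to_def[abs_def] ins_prob_def[abs_def])

lemma avg_ins_prob_ge: "p0 * lam \<le> avg t ins_prob"
  by (intro avg_ge ins_prob_ge)

lemma avg_ins_prob_pos: "0 < avg t ins_prob"
  using avg_ins_prob_ge[of t] mult_pos_pos[OF p0 lam(1)] by linarith

lemma convergent_cond_dist: "convergent (\<lambda>t. cond_dist f M p0 p1 lam init t x)"
proof -
  have "convergent (\<lambda>t. avg t (ins_to x))" "convergent (\<lambda>t. avg t ins_prob)"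
    by (rule convergent_avg[where a=0 and b=1]; simp add: ins_to_def ins_prob_def)+
  then obtain A B where AB: "(\<lambda>t. avg t (ins_to x)) \<longlonglongrightarrow> A" "(\<lambda>t. avg t ins_prob) \<longlonglongrightarrow> B"
    by (auto simp: convergent_def)
  have "p0 * lam \<le> B"
    using AB(2) avg_ins_prob_ge by (intro LIMSEQ_le_const) auto
  then have "B \<noteq> 0"
    using mult_pos_pos[OF p0 lam(1)] by auto
  then have "(\<lambda>t. cond_dist f M p0 p1 lam init t x) \<longlonglongrightarrow> A / B"
    unfolding cond_dist_eq by (intro tendsto_divide AB)
  then show ?thesis
    by (auto simp: convergent_def)
qed

abbreviation steady :: "state \<Rightarrow> real" where
  "steady \<equiv> cond_steady f M p0 p1 lam init"

lemma cond_dist_tendsto: "(\<lambda>t. cond_dist f M p0 p1 lam init t x) \<longlonglongrightarrow> steady x"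
  using convergent_cond_dist[of x] by (simp add: convergent_LIMSEQ_iff cond_steady_def)

lemma steady_nonneg: "0 \<le> steady x"
proof (rule LIMSEQ_le_const[OF cond_dist_tendsto])
  have "0 \<le> avg t (ins_to x)" for t
    by (rule avg_ge) (simp add: ins_to_def)
  then show "\<exists>N. \<forall>t\<ge>N. 0 \<le> cond_dist f M p0 p1 lam init t x"
    by (simp add: cond_dist_eq avg_ins_prob_pos less_imp_le)
qed

lemma steady_eq_0:
  assumes "x \<notin> busy"
  shows "steady x = 0"
proof -
  have "cond_dist f M p0 p1 lam init t x = 0" for t
  proof -
    \<comment> \<open>Zero is written as an empty sum so that \<open>avg_sum\<close> evaluates its
      average.\<close>
    have "avg t (ins_to x) = avg t (\<lambda>s. \<Sum>x\<in>{}. 0)"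
      by (rule avg_cong) (simp add: ins_to_eq_0 assms)
    then show ?thesis
      by (simp only: avg_sum cond_dist_eq) simp
  qed
  then show ?thesis
    using LIMSEQ_unique[OF cond_dist_tendsto[of x]] by simp
qed

text \<open>Every conditional distribution has mass 1 on \<open>busy\<close>, and as
  \<open>busy\<close> is finite no mass escapes in the limit.\<close>

lemma sum_steady: "(\<Sum>x\<in>busy. steady x) = 1"
proof -
  have "(\<Sum>x\<in>busy. cond_dist f M p0 p1 lam init t x) = 1" for t
  proof -
    have "(\<Sum>x\<in>busy. avg t (ins_to x)) = avg t ins_prob"
      unfolding avg_sum[symmetric] by (rule avg_cong) (rule sum_ins_to)
    then show ?thesis
      using avg_ins_prob_pos[of t] by (simp add: cond_dist_eq sum_divide_distrib[symmetric])
  qed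
  moreover have "(\<lambda>t. \<Sum>x\<in>busy. cond_dist f M p0 p1 lam init t x) \<longlonglongrightarrow> (\<Sum>x\<in>busy. steady x)"
    by (intro tendsto_sum cond_dist_tendsto)
  ultimately show ?thesis
    using LIMSEQ_unique[OF _ tendsto_const] by (auto simp: LIMSEQ_const_iff)
qed

text \<open>\<open>embed_pmf\<close> is meaningful only for a nonnegative function of total mass 1;
  this certifies that the initial law of \<open>tagged_space\<close> is the intended one.\<close>

lemma pmf_steady: "pmf (embed_pmf steady) x = steady x"
proof (rule pmf_embed_pmf[OF steady_nonneg])
  have "(\<integral>\<^sup>+ x. ennreal (steady x) \<partial>count_space UNIV) = (\<Sum>x\<in>busy. ennreal (steady x))"
    by (rule nn_integral_count_space'[OF finite_busy]) (auto simp: steady_eq_0)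
  then show "(\<integral>\<^sup>+ x. ennreal (steady x) \<partial>count_space UNIV) = 1"
    by (subst (asm) sum_ennreal) (simp_all add: steady_nonneg sum_steady)
qed

lemma expectation_steady:
  "measure_pmf.expectation (embed_pmf steady) h = (\<Sum>x\<in>busy. steady x * h x)" for h :: "state \<Rightarrow> real"
  by (subst integral_measure_pmf[OF finite_busy])
    (auto simp: pmf_steady set_pmf_eq intro: steady_eq_0 ccontr)

end

section \<open>The source delay\<close>

text \<open>Layer-cake formula: the sum of \<open>v u\<close> over \<open>u < U\<close> is the
  series of \<open>v u\<close> times the indicator of \<open>u < U\<close>. The weights 1 and 2u + 1
  yield U and its square, and integrability comes together with the value.\<close>

lemma (in prob_space) moments_from_tails:
  fixes U :: "'a \<Rightarrow> nat" and v :: "nat \<Rightarrow> real"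
  assumes [measurable]: "U \<in> measurable M (count_space UNIV)"
    and v: "\<And>u. 0 \<le> v u"
    and S: "(\<lambda>u. v u * prob {x \<in> space M. u < U x}) sums S"
  shows "has_bochner_integral M (\<lambda>x. \<Sum>u<U x. v u) S"
proof (rule has_bochner_integral_nn_integral)
  have [measurable]: "(\<lambda>n. \<Sum>u<n. v u) \<in> borel_measurable (count_space UNIV)"
    by simp
  show "(\<lambda>x. \<Sum>u<U x. v u) \<in> borel_measurable M"
    by measurable
  have S_eq: "S = (\<Sum>u. v u * prob {x \<in> space M. u < U x})"
    using S by (rule sums_unique)
  show "0 \<le> S"
    unfolding S_eq using S v by (intro suminf_nonneg) (auto simp: sums_iff)
  have "(\<integral>\<^sup>+ x. ennreal (\<Sum>u<U x. v u) \<partial>M)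
      = (\<integral>\<^sup>+ x. (\<Sum>u. ennreal (v u) * indicator {x \<in> space M. u < U x} x) \<partial>M)"
  proof (rule nn_integral_cong)
    fix x assume "x \<in> space M"
    then have "(\<Sum>u. ennreal (v u) * indicator {x \<in> space M. u < U x} x) = (\<Sum>u<U x. ennreal (v u))"
      by (subst suminf_finite[of "{..<U x}"]) (auto simp: indicator_def)
    then show "ennreal (\<Sum>u<U x. v u) = (\<Sum>u. ennreal (v u) * indicator {x \<in> space M. u < U x} x)"
      by (simp add: v)
  qed
  also have "\<dots> = (\<Sum>u. ennreal (v u) * emeasure M {x \<in> space M. u < U x})"
    by (simp add: nn_integral_suminf nn_integral_cmult_indicator)
  also have "\<dots> = (\<Sum>u. ennreal (v u * prob {x \<in> space M. u < U x}))"
    by (simp add: emeasure_eq_measure ennreal_mult v)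
  also have "\<dots> = ennreal S"
    unfolding S_eq using S v by (intro suminf_ennreal2) (auto simp: sums_iff)
  finally show "(\<integral>\<^sup>+ x. ennreal (\<Sum>u<U x. v u) \<partial>M) = ennreal S" .
qed (simp add: v sum_nonneg)

definition deps :: "nat \<Rightarrow> nat \<Rightarrow> nat \<Rightarrow> sample \<Rightarrow> nat" where
  "deps f M u \<omega> = card {i. i < u \<and> departs_in f M i \<omega>}"

lemma deps_0 [simp]: "deps f M 0 \<omega> = 0"
  by (simp add: deps_def)

lemma deps_Suc: "deps f M (Suc u) \<omega> = deps f M u \<omega> + (if departs_in f M u \<omega> then 1 else 0)"
proof -
  have "{i. i < Suc u \<and> departs_in f M i \<omega>} =
      (if departs_in f M u \<omega> then insert u {i. i < u \<and> departs_in f M i \<omega>}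
       else {i. i < u \<and> departs_in f M i \<omega>})"
    by (auto simp: less_Suc_eq)
  then show ?thesis
    by (simp add: deps_def)
qed

lemma deps_mono: "u \<le> v \<Longrightarrow> deps f M u \<omega> \<le> deps f M v \<omega>"
  by (rule lift_Suc_mono_le) (simp_all add: deps_Suc)

text \<open>A discrete intermediate value property: the count starts at 0 and grows by at most 1 per
  slot.\<close>

lemma deps_hits: "l \<le> deps f M u \<omega> \<Longrightarrow> \<exists>v\<le>u. deps f M v \<omega> = l"
proof (induction u)
  case (Suc u)
  then show ?case
    by (cases "l \<le> deps f M u \<omega>") (auto simp: deps_Suc le_Suc_eq split: if_splits)
qed auto

lemma source_delay_eq: "source_delay f M \<omega> = Inf {u. deps f M u \<omega> = fst (fst \<omega>)}"
  by (simp add: source_delay_def deps_def)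

text \<open>The hypothesis says that the tagged packet does leave, which excludes the default value
  of the infimum of the empty set; the rest is monotonicity of the count.\<close>

lemma source_delay_gt_iff:
  assumes "fst (fst \<omega>) \<le> deps f M v \<omega>"
  shows "u < source_delay f M \<omega> \<longleftrightarrow> deps f M u \<omega> < fst (fst \<omega>)"
proof -
  let ?A = "{u. deps f M u \<omega> = fst (fst \<omega>)}"
  have "?A \<noteq> {}"
    using deps_hits[OF assms] by auto
  then have U: "deps f M (source_delay f M \<omega>) \<omega> = fst (fst \<omega>)"
    using Inf_nat_def1[of ?A] by (simp add: source_delay_eq)
  show ?thesis
  proof
    assume "u < source_delay f M \<omega>"
    then have "v \<notin> ?A" if "v \<le> u" for v
      using cInf_lower[of v ?A] that by (auto simp: source_delay_eq)
    then show "deps f M u \<omega> < fst (fst \<omega>)"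
      using deps_hits[of "fst (fst \<omega>)" f M u \<omega>] by (auto simp: not_le[symmetric])
  next
    assume "deps f M u \<omega> < fst (fst \<omega>)"
    then show "u < source_delay f M \<omega>"
      using deps_mono[of "source_delay f M \<omega>" u f M \<omega>] U by (auto simp: not_le[symmetric])
  qed
qed

section \<open>Tail probabilities of the departure count\<close>

context pd_queue
begin

lemma deps_case_nat:
  "deps f M (Suc u) (s, case_nat w \<omega>) =
    (if departs f w s then 1 else 0) + deps f M u (step f M w s, \<omega>)"
proof (induction u)
  case 0
  then show ?case
    by (simp add: deps_Suc departs_in_def)
next
  case (Suc u)
  have "departs_in f M (Suc u) (s, case_nat w \<omega>) = departs_in f M u (step f M w s, \<omega>)"
    unfolding departs_in_def X_case_nat by simp
  then show ?case
    using Suc by (simp add: deps_Suc[of _ _ "Suc u"] deps_Suc[of _ _ u "(step f M w s, \<omega>)"])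
qed

lemma measurable_deps [measurable]:
  "deps f M u \<in> measurable (queue_space p0 p1 lam init) (count_space UNIV)"
  by (induction u) (simp_all add: deps_Suc[abs_def] deps_def[of _ _ 0, abs_def])

lemma measurable_fst_queue_space [measurable]:
  "fst \<in> measurable (queue_space p0 p1 lam init) (count_space UNIV)"
  using measurable_X[of 0 init] by (simp cong: measurable_cong)

lemma measurable_deps_length [measurable]:
  "Measurable.pred (queue_space p0 p1 lam init) (\<lambda>\<omega>. Q (deps f M u \<omega>) (fst (fst \<omega>)))"
  by (rule measurable_compose_countable[OF _ measurable_fst_queue_space,
      of "\<lambda>x \<omega>. Q (deps f M u \<omega>) (fst x)"])
    (rule measurable_compose[OF measurable_deps], simp)

lemma measurable_source_delay [measurable]:
  "source_delay f M \<in> measurable (queue_space p0 p1 lam init) (count_space UNIV)"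
proof -
  have "source_delay f M = (\<lambda>\<omega>. LEAST u. deps f M u \<omega> = fst (fst \<omega>))"
    by (simp add: fun_eq_iff source_delay_eq Inf_nat_def)
  then show ?thesis
    using measurable_Least[OF measurable_deps_length[where Q="(=)"]] by simp
qed

text \<open>\<open>tail u k j\<close> is the probability that fewer than \<open>k\<close> packets leave in \<open>u\<close> slots, when
  \<open>j\<close> dispatches have been made for the head-of-line packet. As long as at least \<open>k\<close> packets are
  queued at the start, neither their number nor later arrivals matter.\<close>

primrec tail :: "nat \<Rightarrow> nat \<Rightarrow> nat \<Rightarrow> real" where
  "tail 0 k j = (if k = 0 then 0 else 1)"
| "tail (Suc u) k j = (if k = 0 then 0 else
     p0 * tail u (k - 1) 0
     + p1 * (if j = f - 1 then tail u (k - 1) 0 else tail u k (j + 1))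
     + (1 - p0 - p1) * tail u k j)"

text \<open>The induction generalises the threshold: a departure lowers both \<open>k\<close> and
  the queue length by one and an arrival can only lengthen the queue, so
  \<open>k \<le> fst s\<close> is preserved.\<close>

lemma measure_noise_deps:
  assumes "k \<le> fst s" "snd s < f"
  shows "measure noise {\<omega>. deps f M u (s, \<omega>) < k} = tail u k (snd s)"
  using assms
proof (induction u arbitrary: k s)
  case 0
  interpret N: prob_space noise by (rule prob_space_noise)
  show ?case
    using N.prob_space by simp
next
  case (Suc u)
  show ?case
  proof (cases "k = 0")
    case False
    have *: "Measurable.pred noise (\<lambda>\<omega>. deps f M (Suc u) (s, \<omega>) < k)"
      by (rule measurable_section) measurable
    have **: "measure noise {\<omega>. (if departs f w s then 1 else 0) + deps f M u (step f M w s, \<omega>) < k}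
      = (if departs f w s then tail u (k - 1) 0
         else tail u k (if fst w = Packet_Dispatch then snd s + 1 else snd s))" for w
    proof (cases "departs f w s")
      case True
      then have "k - 1 \<le> fst (step f M w s)" "snd (step f M w s) = 0"
        using Suc.prems by (auto simp: step_def after_transmission_def Let_def)
      moreover have "1 + deps f M u (step f M w s, \<omega>) < k \<longleftrightarrow> deps f M u (step f M w s, \<omega>) < k - 1" for \<omega>
        using False by auto
      ultimately show ?thesis
        using True Suc.IH[of "k - 1" "step f M w s"] f by simp
    next
      case dep: False
      then have "k \<le> fst (step f M w s)"
        "snd (step f M w s) = (if fst w = Packet_Dispatch then snd s + 1 else snd s)"
        "snd (step f M w s) < f"
        using Suc.prems False
        by (auto simp: step_def after_transmission_def Let_def departs_def)
      then show ?thesis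
        using dep Suc.IH[of k "step f M w s"] by simp
    qed
    have "measure noise {\<omega>. deps f M (Suc u) (s, \<omega>) < k} = measure_pmf.expectation slots
        (\<lambda>w. measure noise {\<omega>. (if departs f w s then 1 else 0) + deps f M u (step f M w s, \<omega>) < k})"
      by (subst measure_noise_first_slot[OF *]) (simp only: deps_case_nat)
    also have "\<dots> = tail (Suc u) k (snd s)"
      unfolding ** expectation_slots
      using Suc.prems False by (simp add: departs_def algebra_simps)
    finally show ?thesis .
  qed simp
qed

lemma tail_0 [simp]: "tail u 0 j = 0"
  by (cases u) simp_all

lemma tail_nonneg: "0 \<le> tail u k j"
  using p0 p1 p01 by (induction u arbitrary: k j) auto

lemma tail_le_1: "tail u k j \<le> 1"
proof (induction u arbitrary: k j)
  case (Suc u)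
  have "p0 * tail u (k - 1) 0 + p1 * (if j = f - 1 then tail u (k - 1) 0 else tail u k (j + 1))
      + (1 - p0 - p1) * tail u k j \<le> p0 * 1 + p1 * 1 + (1 - p0 - p1) * 1"
    using p0 p1 p01 Suc by (intro add_mono mult_left_mono) auto
  then show ?case
    by simp
qed simp

text \<open>If the first k slots all have a source-destination outcome, k packets have left. In the
  induction only that branch uses the hypothesis; the other two are bounded by 1.\<close>

lemma tail_le: "k \<le> u \<Longrightarrow> tail u k j \<le> 1 - p0 ^ k"
proof (induction u arbitrary: k j)
  case (Suc u)
  show ?case
  proof (cases k)
    case (Suc k')
    have "p0 * tail u k' 0 + p1 * (if j = f - 1 then tail u k' 0 else tail u k (j + 1))
        + (1 - p0 - p1) * tail u k j \<le> p0 * (1 - p0 ^ k') + p1 * 1 + (1 - p0 - p1) * 1"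
      using p0 p1 p01 Suc.IH[of k' 0] Suc.prems Suc tail_le_1
      by (intro add_mono mult_left_mono) auto
    then show ?thesis
      using Suc by (cases "j = f - 1") (simp_all add: algebra_simps)
  qed simp
qed simp

text \<open>The recursion consumes the first u slots, so the extra M slots come last, in whatever
  situation has then been reached; the base case bounds that uniformly by
  \<open>tail_le\<close>.\<close>

lemma tail_add_le:
  assumes "k \<le> M"
  shows "tail (u + M) k j \<le> (1 - p0 ^ M) * tail u k j"
  using assms
proof (induction u arbitrary: k j)
  case 0
  have "p0 ^ M \<le> p0 ^ k"
    using p0 p1 p01 0 by (intro power_decreasing) auto
  then show ?case
    using tail_le[of k M j] 0 by auto
next
  case (Suc u)
  show ?case
  proof (cases "k = 0")
    case False
    have "tail (Suc u + M) k j = p0 * tail (u + M) (k - 1) 0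
        + p1 * (if j = f - 1 then tail (u + M) (k - 1) 0 else tail (u + M) k (j + 1))
        + (1 - p0 - p1) * tail (u + M) k j"
      using False by simp
    also have "\<dots> \<le> p0 * ((1 - p0 ^ M) * tail u (k - 1) 0)
        + p1 * ((1 - p0 ^ M) * (if j = f - 1 then tail u (k - 1) 0 else tail u k (j + 1)))
        + (1 - p0 - p1) * ((1 - p0 ^ M) * tail u k j)"
      using p0 p1 p01 Suc.IH Suc.prems by (intro add_mono mult_left_mono) auto
    also have "\<dots> = (1 - p0 ^ M) * tail (Suc u) k j"
      using False by (simp add: algebra_simps)
    finally show ?thesis .
  qed simp
qed

lemma tail_geometric:
  obtains r C where "0 < r" "r < 1" "0 \<le> C" "\<And>u k j. k \<le> M \<Longrightarrow> tail u k j \<le> C * r ^ u"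
proof -
  define q where "q = 1 - p0 ^ M"
  have "p0 ^ M < 1"
    using p0 p1 p01 M by (intro power_less_one_iff[THEN iffD2]) auto
  then have q: "0 < q" "q < 1"
    using p0 by (auto simp: q_def)
  \<comment> \<open>The M-th root spreads the factor \<open>q\<close> gained per M slots evenly over
    single slots; the constant \<open>1 / q\<close> pays for the first M slots, where
    \<open>r ^ u \<ge> q\<close>.\<close>
  define r where "r = root M q"
  have r: "0 < r" "r < 1" "r ^ M = q"
    using q M by (auto simp: r_def)
  have "tail u k j \<le> 1 / q * r ^ u" if "k \<le> M" for u k j
  proof (induction u rule: less_induct)
    case (less u)
    show ?case
    proof (cases "u < M")
      case True
      then have "r ^ M \<le> r ^ u"
        using r by (intro power_decreasing) auto
      then have "1 \<le> 1 / q * r ^ u"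
        using q r by simp
      then show ?thesis
        using tail_le_1[of u k j] by linarith
    next
      case False
      then have u: "u = (u - M) + M"
        by simp
      have "tail u k j \<le> q * tail (u - M) k j"
        using tail_add_le[OF that, of "u - M" j] False by (simp add: q_def)
      also have "\<dots> \<le> q * (1 / q * r ^ (u - M))"
        using less[of "u - M"] False M q by (intro mult_left_mono) auto
      also have "\<dots> = 1 / q * r ^ u"
        by (subst (2) u) (simp add: power_add r(3))
      finally show ?thesis .
    qed
  qed
  with r q show ?thesis
    by (intro that[of r "1 / q"]) auto
qed

lemma tail_tendsto_0:
  assumes "k \<le> M"
  shows "(\<lambda>u. tail u k j) \<longlonglongrightarrow> 0"
proof -
  obtain r C where r: "0 < r" "r < 1" "0 \<le> C" "\<And>u k j. k \<le> M \<Longrightarrow> tail u k j \<le> C * r ^ u"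
    using tail_geometric by metis
  have "(\<lambda>u. C * r ^ u) \<longlonglongrightarrow> C * 0"
    using r by (intro tendsto_mult tendsto_const LIMSEQ_power_zero) auto
  then show ?thesis
    using tendsto_sandwich[of "\<lambda>_. 0" "\<lambda>u. tail u k j" sequentially "\<lambda>u. C * r ^ u" 0]
      tail_nonneg r(4)[OF assms] by auto
qed

end

section \<open>The law of the source delay\<close>

context pd_queue_from
begin

abbreviation tagged :: "sample measure" where
  "tagged \<equiv> tagged_space f M p0 p1 lam init"

definition delay_tail :: "nat \<Rightarrow> real" where
  "delay_tail u = (\<Sum>x\<in>busy. steady x * tail u (fst x) (snd x))"

lemma prob_space_tagged: "prob_space tagged"
proof -
  interpret N: prob_space noise by (rule prob_space_noise)
  interpret pair_prob_space "embed_pmf steady" noise ..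
  show ?thesis
    unfolding tagged_space_def queue_space_def by (rule P.prob_space_axioms)
qed

lemma space_tagged [simp]: "space tagged = UNIV"
  by (simp add: tagged_space_def)

lemma measurable_source_delay_tagged [measurable]:
  "source_delay f M \<in> measurable tagged (count_space UNIV)"
  unfolding tagged_space_def by measurable

lemma delay_tail_tendsto_0: "delay_tail \<longlonglongrightarrow> 0"
proof -
  have "(\<lambda>u. \<Sum>x\<in>busy. steady x * tail u (fst x) (snd x)) \<longlonglongrightarrow> (\<Sum>x\<in>busy. steady x * 0)"
    by (intro tendsto_sum tendsto_mult tendsto_const tail_tendsto_0) (auto simp: busy_def)
  then show ?thesis
    by (simp add: delay_tail_def[abs_def])
qed

lemma sets_deps: "{\<omega>. deps f M u \<omega> < fst (fst \<omega>)} \<in> sets tagged"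
proof -
  have "Measurable.pred tagged (\<lambda>\<omega>. deps f M u \<omega> < fst (fst \<omega>))"
    unfolding tagged_space_def by (rule measurable_deps_length)
  then show ?thesis
    by (simp add: pred_def)
qed

lemma measure_deps: "measure tagged {\<omega>. deps f M u \<omega> < fst (fst \<omega>)} = delay_tail u"
proof -
  have "measure tagged {\<omega>. deps f M u \<omega> < fst (fst \<omega>)}
      = (\<Sum>x\<in>busy. steady x * measure noise {\<omega>. deps f M u (x, \<omega>) < fst x})"
    unfolding tagged_space_def
    by (subst measure_queue_space) (simp_all add: expectation_steady)
  also have "\<dots> = delay_tail u"
    unfolding delay_tail_def
    by (intro sum.cong refl) (subst measure_noise_deps, auto simp: busy_def)
  finally show ?thesis .
qed

text \<open>The event that the packet never leaves lies inside every tail event, and the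
  probabilities of these tend to 0.\<close>

lemma AE_removed: "AE \<omega> in tagged. \<exists>v. fst (fst \<omega>) \<le> deps f M v \<omega>"
proof -
  interpret prob_space tagged by (rule prob_space_tagged)
  let ?B = "{\<omega>. \<forall>v. deps f M v \<omega> < fst (fst \<omega>)}"
  have B: "?B = (\<Inter>v. {\<omega>. deps f M v \<omega> < fst (fst \<omega>)})"
    by auto
  have "?B \<in> sets tagged"
    unfolding B using sets_deps by (intro sets.countable_INT) auto
  moreover have "prob ?B \<le> 0"
  proof (rule LIMSEQ_le_const[OF delay_tail_tendsto_0], intro exI allI impI)
    fix u :: nat
    show "prob ?B \<le> delay_tail u"
      unfolding measure_deps[symmetric] using sets_deps by (intro finite_measure_mono) auto
  qed
  ultimately have "?B \<in> null_sets tagged"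
    by (simp add: null_sets_def emeasure_eq_measure measure_le_0_iff)
  then show ?thesis
    by (rule AE_I') (auto simp: not_le)
qed

lemma prob_source_delay_gt: "measure tagged {\<omega>. u < source_delay f M \<omega>} = delay_tail u"
proof -
  interpret prob_space tagged by (rule prob_space_tagged)
  have "AE \<omega> in tagged. \<omega> \<in> {\<omega>. u < source_delay f M \<omega>} \<longleftrightarrow> \<omega> \<in> {\<omega>. deps f M u \<omega> < fst (fst \<omega>)}"
    using AE_removed by eventually_elim (auto simp: source_delay_gt_iff)
  moreover have "{\<omega> \<in> space tagged. u < source_delay f M \<omega>} \<in> sets tagged"
    by measurable
  ultimately show ?thesis
    unfolding measure_deps[symmetric] using sets_deps by (intro finite_measure_eq_AE) simp_all
qed

lemma prob_source_delay_le: "measure tagged {\<omega>. source_delay f M \<omega> \<le> u} = 1 - delay_tail u"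
proof -
  interpret prob_space tagged by (rule prob_space_tagged)
  have "{\<omega> \<in> space tagged. u < source_delay f M \<omega>} \<in> sets tagged"
    by measurable
  then have "prob (space tagged - {\<omega>. u < source_delay f M \<omega>}) = 1 - delay_tail u"
    by (subst prob_compl) (simp_all add: prob_source_delay_gt)
  moreover have "space tagged - {\<omega>. u < source_delay f M \<omega>} = {\<omega>. source_delay f M \<omega> \<le> u}"
    by auto
  ultimately show ?thesis
    by simp
qed

lemma prob_source_delay_eq:
  assumes "u \<ge> 1"
  shows "measure tagged {\<omega>. source_delay f M \<omega> = u} = delay_tail (u - 1) - delay_tail u"
proof -
  interpret prob_space tagged by (rule prob_space_tagged)
  have *: "{\<omega> \<in> space tagged. v < source_delay f M \<omega>} \<in> sets tagged" for v
    by measurable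
  have "{\<omega>. source_delay f M \<omega> = u} =
      {\<omega>. u - 1 < source_delay f M \<omega>} - {\<omega>. u < source_delay f M \<omega>}"
    using assms by auto
  also have "prob \<dots> = prob {\<omega>. u - 1 < source_delay f M \<omega>} - prob {\<omega>. u < source_delay f M \<omega>}"
    using *[of u] *[of "u - 1"] by (intro finite_measure_Diff) auto
  finally show ?thesis
    by (simp only: prob_source_delay_gt)
qed

end

section \<open>The matrix \<open>T\<close>\<close>

lemma block_eq_iff:
  fixes a b x y f :: nat
  assumes "x < f" "y < f"
  shows "a * f + x = b * f + y \<longleftrightarrow> a = b \<and> x = y"
proof
  assume "a * f + x = b * f + y"
  then have "(a * f + x) div f = (b * f + y) div f" "(a * f + x) mod f = (b * f + y) mod f"
    by simp_all
  then show "a = b \<and> x = y"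
    using assms by simp
qed simp

text \<open>After a removal the new head-of-line packet has no dispatches yet, so this rank-one
  block lives in its first column.\<close>

lemma A2_mat_index:
  assumes "i < f" "j < f"
  shows "A2_mat f p0 p1 $$ (i, j) = (if j = 0 then c_vec f p0 p1 $ i else 0)"
proof -
  have "A2_mat f p0 p1 $$ (i, j) = row (mat_of_cols f [c_vec f p0 p1]) i \<bullet> col (mat_of_rows f [r_vec f]) j"
    using assms by (simp add: A2_mat_def)
  also have "\<dots> = c_vec f p0 p1 $ i * r_vec f $ j"
    using assms by (simp add: scalar_prod_def mat_of_cols_def mat_of_rows_def c_vec_def r_vec_def)
  finally show ?thesis
    using assms by (simp add: r_vec_def)
qed

lemma pow_mat_mult_vec_Suc:
  fixes A :: "'a :: comm_semiring_1 mat"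
  assumes "A \<in> carrier_mat d d" "v \<in> carrier_vec d"
  shows "A ^\<^sub>m Suc n *\<^sub>v v = A ^\<^sub>m n *\<^sub>v (A *\<^sub>v v)"
  using assms by (simp add: assoc_mult_mat_vec[of _ d d])

text \<open>Peeling off the outer factor matches the first-slot recursion of \<open>tail\<close>;
  the other form, with the inner factor, is the one that telescopes.\<close>

lemma pow_mat_mult_vec_Suc':
  fixes A :: "'a :: comm_semiring_1 mat"
  assumes "A \<in> carrier_mat d d" "v \<in> carrier_vec d"
  shows "A ^\<^sub>m Suc n *\<^sub>v v = A *\<^sub>v (A ^\<^sub>m n *\<^sub>v v)"
  using assms(2)
proof (induction n arbitrary: v)
  case 0
  then show ?case
    using assms(1) by simp
next
  case (Suc n)
  have Av: "A *\<^sub>v v \<in> carrier_vec d"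
    using assms(1) Suc.prems by (rule mult_mat_vec_carrier)
  show ?case
    unfolding pow_mat_mult_vec_Suc[OF assms(1) Suc.prems, of "Suc n"] Suc.IH[OF Av]
      pow_mat_mult_vec_Suc[OF assms(1) Suc.prems, of n] ..
qed

context pd_queue
begin

abbreviation T :: "real mat" where
  "T \<equiv> T_mat f M p0 p1 (1 - p0 - p1)"

abbreviation d :: nat where
  "d \<equiv> M * f"

lemma T_carrier [simp]: "T \<in> carrier_mat d d"
  by (simp add: T_mat_def Q_mat_def)

lemma dim_T [simp]: "dim_row T = d" "dim_col T = d"
  using T_carrier by (simp_all only: carrier_mat_def mem_Collect_eq)

lemma T_pow_carrier [simp]: "T ^\<^sub>m n \<in> carrier_mat d d"
  by (rule pow_carrier_mat) simp

text \<open>One entry formula for \<open>M = 1\<close> and \<open>M \<ge> 2\<close>: nothing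
  happens, a dispatch moves one index on within the block, a removal goes to the start of the
  preceding block. The guard \<open>i div f \<noteq> 0\<close> is essential: with truncated
  subtraction block 0 would otherwise return to itself, whereas there the removed packet is the
  tagged one.\<close>

lemma T_index:
  assumes "i < d" "i' < d"
  shows "T $$ (i, i') =
    (if i' = i then 1 - p0 - p1 else 0)
    + (if i' = i + 1 \<and> i mod f \<noteq> f - 1 then p1 else 0)
    + (if i' = (i div f - 1) * f \<and> i div f \<noteq> 0 then p0 + (if i mod f = f - 1 then p1 else 0) else 0)"
proof -
  obtain a j a' j' where ij: "i = a * f + j" "j < f" "i' = a' * f + j'" "j' < f"
    using f by (metis div_mult_mod_eq mod_less_divisor less_eq_Suc_le One_nat_def)
  have dm: "i div f = a" "i mod f = j" "i' div f = a'" "i' mod f = j'"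
    using ij by simp_all
  have "i' = i \<longleftrightarrow> a' = a \<and> j' = j"
    unfolding ij by (rule block_eq_iff) (use ij in auto)
  moreover have "i' = i + 1 \<and> j \<noteq> f - 1 \<longleftrightarrow> a' = a \<and> j' = j + 1"
  proof (cases "j = f - 1")
    case False
    then show ?thesis
      using block_eq_iff[of j' f "j + 1" a' a] ij by simp
  qed (use ij in auto)
  moreover have "i' = (a - 1) * f \<longleftrightarrow> a' = a - 1 \<and> j' = 0"
    using block_eq_iff[of j' f 0 a' "a - 1"] ij by simp
  ultimately have rhs:
    "(if i' = i then 1 - p0 - p1 else 0)
      + (if i' = i + 1 \<and> j \<noteq> f - 1 then p1 else 0)
      + (if i' = (a - 1) * f \<and> a \<noteq> 0 then p0 + (if j = f - 1 then p1 else 0) else 0)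
    = (if a' = a \<and> j' = j then 1 - p0 - p1 else 0)
      + (if a' = a \<and> j' = j + 1 then p1 else 0)
      + (if a' = a - 1 \<and> j' = 0 \<and> a \<noteq> 0 then p0 + (if j = f - 1 then p1 else 0) else 0)"
    by simp
  have Q: "Q_mat f p1 (1 - p0 - p1) $$ (j, j') =
      (if j' = j then 1 - p0 - p1 else if j' = j + 1 then p1 else 0)"
    using ij by (simp add: Q_mat_def)
  show ?thesis
  proof (cases "M = 1")
    case True
    then have "a = 0" "a' = 0"
      using assms dm by auto
    then show ?thesis
      unfolding dm rhs using True Q ij by (simp add: T_mat_def)
  next
    case False
    then have "T $$ (i, i') = T_block f M p0 p1 (1 - p0 - p1) a a' $$ (j, j')"
      using assms by (simp add: T_mat_def dm)
    also have "\<dots> = (if a = a' then Q_mat f p1 (1 - p0 - p1) $$ (j, j')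
        else if a = a' + 1 then (if j' = 0 then p0 + (if j = f - 1 then p1 else 0) else 0)
        else 0)"
      using ij
      by (auto simp: T_block_def AM_mat_def A1_mat_def A0_mat_def A2_mat_index c_vec_def)
    finally show ?thesis
      unfolding dm rhs Q by auto
  qed
qed

lemma index_pred_block:
  "i div f \<noteq> 0 \<Longrightarrow> (i div f - 1) * f div f + 1 = i div f \<and> (i div f - 1) * f mod f = 0"
  using f by simp

lemma index_Suc:
  "i mod f \<noteq> f - 1 \<Longrightarrow> (i + 1) div f = i div f \<and> (i + 1) mod f = i mod f + 1"
  using f by (auto simp: div_Suc mod_Suc)

lemma index_bounds:
  assumes "i < d"
  shows "(i div f - 1) * f < d" "i mod f \<noteq> f - 1 \<Longrightarrow> i + 1 < d"
proof -
  have div_less: "i div f < M"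
    using assms by (simp add: less_mult_imp_div_less)
  then show "(i div f - 1) * f < d"
    using f by (intro mult_strict_right_mono) auto
  assume "i mod f \<noteq> f - 1"
  then have "(i + 1) div f < M"
    using div_less index_Suc by simp
  then show "i + 1 < d"
    using f by (simp add: div_less_iff_less_mult)
qed

lemma T_mult_vec_index:
  assumes "i < d" "v \<in> carrier_vec d"
  shows "(T *\<^sub>v v) $ i =
    (if i div f = 0 then 0
     else (p0 + (if i mod f = f - 1 then p1 else 0)) * v $ ((i div f - 1) * f))
    + (if i mod f = f - 1 then 0 else p1 * v $ (i + 1))
    + (1 - p0 - p1) * v $ i"
proof -
  note 1 = index_bounds(1)[OF assms(1)] and 2 = index_bounds(2)[OF assms(1)]
  have "(T *\<^sub>v v) $ i = (\<Sum>i'<d. T $$ (i, i') * v $ i')"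
    using assms T_carrier unfolding carrier_mat_def carrier_vec_def
    by (simp add: scalar_prod_def atLeast0LessThan)
  also have "\<dots> = (\<Sum>i'<d. (if i' = i then (1 - p0 - p1) * v $ i' else 0)
      + (if i' = i + 1 then (if i mod f = f - 1 then 0 else p1 * v $ i') else 0)
      + (if i' = (i div f - 1) * f then (if i div f = 0 then 0
          else (p0 + (if i mod f = f - 1 then p1 else 0)) * v $ i') else 0))"
    by (intro sum.cong refl) (use assms in \<open>simp add: T_index distrib_right\<close>)
  also have "\<dots> = (1 - p0 - p1) * v $ i
      + (if i + 1 < d then (if i mod f = f - 1 then 0 else p1 * v $ (i + 1)) else 0)
      + (if i div f = 0 then 0
          else (p0 + (if i mod f = f - 1 then p1 else 0)) * v $ ((i div f - 1) * f))"
    using assms(1) 1 by (simp add: sum.distrib)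
  finally show ?thesis
    using 2 by (auto simp: algebra_simps)
qed

text \<open>Index \<open>i\<close> stands for the state with \<open>i div f + 1\<close> packets left and \<open>i mod f\<close> dispatches
  made, so that \<open>T\<close> realises the recursion of \<open>tail\<close>.\<close>

lemma tail_Suc_index:
  "tail (Suc u) (i div f + 1) (i mod f) =
    (p0 + (if i mod f = f - 1 then p1 else 0)) * tail u (i div f) 0
    + (if i mod f = f - 1 then 0 else p1 * tail u (i div f + 1) (i mod f + 1))
    + (1 - p0 - p1) * tail u (i div f + 1) (i mod f)"
  by (simp add: algebra_simps)

text \<open>The entries of \<open>T\<close> are nonnegative, so the iterates of \<open>w\<close> are
  dominated by those of the constant vector \<open>C\<close>, which are \<open>C\<close> times the
  tails.\<close>

lemma abs_T_pow_le:
  assumes w: "w \<in> carrier_vec d" "\<And>i. i < d \<Longrightarrow> \<bar>w $ i\<bar> \<le> C" and "i < d"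
  shows "\<bar>(T ^\<^sub>m n *\<^sub>v w) $ i\<bar> \<le> C * tail n (i div f + 1) (i mod f)"
  using assms(3)
proof (induction n arbitrary: i)
  case 0
  then show ?case
    using w T_carrier by simp
next
  case (Suc n)
  let ?v = "T ^\<^sub>m n *\<^sub>v w"
  let ?c = "p0 + (if i mod f = f - 1 then p1 else 0)"
  have v: "?v \<in> carrier_vec d"
    using w by (intro mult_mat_vec_carrier[of _ d d]) simp
  have c: "0 \<le> ?c"
    using p0 p1 by simp
  have Suc_n: "(T ^\<^sub>m Suc n *\<^sub>v w) $ i =
      (if i div f = 0 then 0 else ?c * ?v $ ((i div f - 1) * f))
      + (if i mod f = f - 1 then 0 else p1 * ?v $ (i + 1)) + (1 - p0 - p1) * ?v $ i"
    unfolding pow_mat_mult_vec_Suc'[OF T_carrier w(1)] by (rule T_mult_vec_index[OF Suc.prems v])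
  have "\<bar>(T ^\<^sub>m Suc n *\<^sub>v w) $ i\<bar> \<le> (if i div f = 0 then 0 else ?c * \<bar>?v $ ((i div f - 1) * f)\<bar>)
      + (if i mod f = f - 1 then 0 else p1 * \<bar>?v $ (i + 1)\<bar>) + (1 - p0 - p1) * \<bar>?v $ i\<bar>"
    unfolding Suc_n using c p1 p01 by (intro order_trans[OF abs_triangle_ineq] add_mono) (auto simp: abs_mult)
  also have "\<dots> \<le> ?c * (C * tail n (i div f) 0)
      + (if i mod f = f - 1 then 0 else p1 * (C * tail n (i div f + 1) (i mod f + 1)))
      + (1 - p0 - p1) * (C * tail n (i div f + 1) (i mod f))"
  proof (intro add_mono)
    show "(if i div f = 0 then 0 else ?c * \<bar>?v $ ((i div f - 1) * f)\<bar>) \<le> ?c * (C * tail n (i div f) 0)"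
    proof (cases "i div f = 0")
      case False
      then show ?thesis
        using Suc.IH[OF index_bounds(1)[OF Suc.prems]] index_pred_block[OF False] c
        by (simp only: if_False) (rule mult_left_mono)
    qed simp
    show "(if i mod f = f - 1 then 0 else p1 * \<bar>?v $ (i + 1)\<bar>)
        \<le> (if i mod f = f - 1 then 0 else p1 * (C * tail n (i div f + 1) (i mod f + 1)))"
    proof (cases "i mod f = f - 1")
      case False
      then show ?thesis
        using Suc.IH[OF index_bounds(2)[OF Suc.prems False]] index_Suc[OF False] p1
        by (simp only: if_False) (rule mult_left_mono)
    qed simp
    show "(1 - p0 - p1) * \<bar>?v $ i\<bar> \<le> (1 - p0 - p1) * (C * tail n (i div f + 1) (i mod f))"
      using Suc.IH[OF Suc.prems] p01 by (intro mult_left_mono) auto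
  qed
  also have "\<dots> = C * tail (Suc n) (i div f + 1) (i mod f)"
    unfolding tail_Suc_index by (simp add: algebra_simps)
  finally show ?case .
qed

lemma ones_carrier [simp]: "ones d \<in> carrier_vec d"
  by (simp add: ones_def)

lemma T_pow_ones:
  assumes "i < d"
  shows "(T ^\<^sub>m n *\<^sub>v ones d) $ i = tail n (i div f + 1) (i mod f)"
  using assms
proof (induction n arbitrary: i)
  case 0
  then show ?case
    using T_carrier by (simp add: ones_def)
next
  case (Suc n)
  have v: "T ^\<^sub>m n *\<^sub>v ones d \<in> carrier_vec d"
    by (intro mult_mat_vec_carrier[of _ d d]) simp_all
  show ?case
    unfolding pow_mat_mult_vec_Suc'[OF T_carrier ones_carrier] T_mult_vec_index[OF Suc.prems v] tail_Suc_index
    using Suc.IH[OF index_bounds(1)[OF Suc.prems]] Suc.IH[OF index_bounds(2)[OF Suc.prems]]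
      Suc.IH[OF Suc.prems] index_pred_block[of i] index_Suc[of i]
    by auto
qed

text \<open>The defect of the row sums of \<open>T\<close> is the probability that the tagged packet
  leaves in the current slot, which requires it to be at the head of the line, that is in block
  0.\<close>

lemma c_plus_eq: "c_plus f M p0 p1 = ones d - T *\<^sub>v ones d"
proof (rule eq_vecI)
  show "dim_vec (c_plus f M p0 p1) = dim_vec (ones d - T *\<^sub>v ones d)"
    using M T_carrier by (cases M) (auto simp: c_plus_def c_vec_def)
  fix i assume "i < dim_vec (ones d - T *\<^sub>v ones d)"
  then have i: "i < d"
    using T_carrier by simp
  have "c_plus f M p0 p1 $ i =
      (if i div f = 0 then (if i mod f = f - 1 then p0 + p1 else p0) else 0)"
    using i f by (auto simp: c_plus_def c_vec_def div_eq_0_iff diff_mult_distrib)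
  also have "\<dots> = 1 - (T *\<^sub>v ones d) $ i"
    using T_mult_vec_index[OF i ones_carrier] index_bounds[OF i] i
    by (simp add: ones_def del: index_mult_mat_vec)
  finally show "c_plus f M p0 p1 $ i = (ones d - T *\<^sub>v ones d) $ i"
    using i by (simp add: ones_def del: index_mult_mat_vec)
qed

section \<open>Geometric decay of the powers of T and the inverse of I - T\<close>

lemma bounded_vec:
  fixes w :: "real vec"
  assumes "w \<in> carrier_vec n"
  obtains C where "\<And>i. i < n \<Longrightarrow> \<bar>w $ i\<bar> \<le> C"
proof
  fix i assume "i < n"
  then show "\<bar>w $ i\<bar> \<le> (\<Sum>i<n. \<bar>w $ i\<bar>)"
    by (intro member_le_sum) auto
qed

lemma T_pow_geometric:
  assumes "w \<in> carrier_vec d"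
  obtains r C where "0 < r" "r < 1" "0 \<le> C" "\<And>n i. i < d \<Longrightarrow> \<bar>(T ^\<^sub>m n *\<^sub>v w) $ i\<bar> \<le> C * r ^ n"
proof -
  obtain r C where r: "0 < r" "r < 1" "0 \<le> C" "\<And>u k j. k \<le> M \<Longrightarrow> tail u k j \<le> C * r ^ u"
    using tail_geometric by metis
  obtain C' where C': "\<And>i. i < d \<Longrightarrow> \<bar>w $ i\<bar> \<le> C'"
    using bounded_vec[OF assms] by blast
  have "0 < d"
    using f M by simp
  then have "0 \<le> C'"
    using C'[of 0] abs_ge_zero[of "w $ 0"] by linarith
  have "\<bar>(T ^\<^sub>m n *\<^sub>v w) $ i\<bar> \<le> C' * C * r ^ n" if "i < d" for n i
  proof -
    have "i div f + 1 \<le> M"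
      using less_mult_imp_div_less[OF that] by simp
    then have "C' * tail n (i div f + 1) (i mod f) \<le> C' * (C * r ^ n)"
      using \<open>0 \<le> C'\<close> by (intro mult_left_mono r)
    then show ?thesis
      using abs_T_pow_le[OF assms C' that, of n] by (simp add: mult.assoc)
  qed
  then show ?thesis
    using r \<open>0 \<le> C'\<close> that[of r "C' * C"] by simp
qed

text \<open>A kernel vector of \<open>I - T\<close> would be fixed by all powers of
  \<open>T\<close>, yet these send every vector to 0.\<close>

lemma det_one_minus_T: "det (1\<^sub>m d - T) \<noteq> 0"
proof
  assume "det (1\<^sub>m d - T) = 0"
  moreover have "1\<^sub>m d - T \<in> carrier_mat d d"
    by (rule minus_carrier_mat) simp
  ultimately obtain v where v: "v \<in> carrier_vec d" "v \<noteq> 0\<^sub>v d" "(1\<^sub>m d - T) *\<^sub>v v = 0\<^sub>v d"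
    using det_0_iff_vec_prod_zero by blast
  have Tv: "T *\<^sub>v v \<in> carrier_vec d"
    by (rule mult_mat_vec_carrier[OF T_carrier v(1)])
  have "v - T *\<^sub>v v = 0\<^sub>v d"
    using v minus_mult_distrib_mat_vec[OF one_carrier_mat T_carrier v(1)] by simp
  then have "v $ i - (T *\<^sub>v v) $ i = 0" if "i < d" for i
    using that v(1) Tv by (metis carrier_vecD index_minus_vec(1) index_zero_vec(1))
  then have Tv_eq: "T *\<^sub>v v = v"
    using v(1) Tv by (intro eq_vecI) auto
  have pow: "T ^\<^sub>m n *\<^sub>v v = v" for n
  proof (induction n)
    case 0
    then show ?case
      using v(1) T_carrier by simp
  next
    case (Suc n)
    then show ?case
      by (simp only: pow_mat_mult_vec_Suc[OF T_carrier v(1)] Tv_eq)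
  qed
  obtain r C where r: "0 < r" "r < 1" "\<And>n i. i < d \<Longrightarrow> \<bar>(T ^\<^sub>m n *\<^sub>v v) $ i\<bar> \<le> C * r ^ n"
    using T_pow_geometric[OF v(1)] by metis
  have "v $ i = 0" if "i < d" for i
  proof -
    have "(\<lambda>n. C * r ^ n) \<longlonglongrightarrow> C * 0"
      using r by (intro tendsto_mult tendsto_const LIMSEQ_power_zero) auto
    then have "\<bar>v $ i\<bar> \<le> C * 0"
      by (rule LIMSEQ_le_const) (use r(3)[OF that] pow in auto)
    then show ?thesis
      by simp
  qed
  then have "v = 0\<^sub>v d"
    using v(1) by (intro eq_vecI) auto
  with v(2) show False ..
qed

definition R :: "real mat" where
  "R = the (mat_inverse (1\<^sub>m d - T))"

text \<open>The nonzero determinant makes the matrix a unit, so \<open>mat_inverse\<close> returns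
  \<open>Some\<close> and \<open>the\<close> yields a genuine two-sided inverse.\<close>

lemma R: "R \<in> carrier_mat d d" "(1\<^sub>m d - T) * R = 1\<^sub>m d" "R * (1\<^sub>m d - T) = 1\<^sub>m d"
proof -
  have IT: "1\<^sub>m d - T \<in> carrier_mat d d"
    by (rule minus_carrier_mat) simp
  have "1\<^sub>m d - T \<in> Units (ring_mat TYPE(real) d ())"
    by (rule det_non_zero_imp_unit[OF IT det_one_minus_T])
  then obtain B where "mat_inverse (1\<^sub>m d - T) = Some B"
    using mat_inverse(1)[OF IT, of "()"] by (cases "mat_inverse (1\<^sub>m d - T)") auto
  then show "R \<in> carrier_mat d d" "(1\<^sub>m d - T) * R = 1\<^sub>m d" "R * (1\<^sub>m d - T) = 1\<^sub>m d"
    using mat_inverse(2)[OF IT] by (auto simp: R_def)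
qed

lemma invertible_mat_one_minus_T: "invertible_mat (1\<^sub>m d - T)"
  using R T_carrier unfolding invertible_mat_def square_mat.simps inverts_mat_def
  by (metis carrier_matD index_minus_mat(2,3))

lemma R_mult_vec [simp]: "v \<in> carrier_vec d \<Longrightarrow> R *\<^sub>v v \<in> carrier_vec d"
  by (rule mult_mat_vec_carrier[OF R(1)])

lemma T_mult_vec [simp]: "v \<in> carrier_vec d \<Longrightarrow> T *\<^sub>v v \<in> carrier_vec d"
  by (rule mult_mat_vec_carrier[OF T_carrier])

lemma T_pow_mult_vec [simp]: "v \<in> carrier_vec d \<Longrightarrow> T ^\<^sub>m n *\<^sub>v v \<in> carrier_vec d"
  by (rule mult_mat_vec_carrier[OF T_pow_carrier])

lemma R_minus_T_R:
  assumes "v \<in> carrier_vec d"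
  shows "R *\<^sub>v v - T *\<^sub>v (R *\<^sub>v v) = v"
proof -
  have "R *\<^sub>v v - T *\<^sub>v (R *\<^sub>v v) = (1\<^sub>m d - T) *\<^sub>v (R *\<^sub>v v)"
    using assms by (subst minus_mult_distrib_mat_vec[of _ d d]) simp_all
  also have "\<dots> = v"
    using assms R by (subst assoc_mult_mat_vec[symmetric, of _ d d _ d]) (auto intro: minus_carrier_mat)
  finally show ?thesis .
qed

lemma R_c_plus: "R *\<^sub>v c_plus f M p0 p1 = ones d"
proof -
  have "c_plus f M p0 p1 = (1\<^sub>m d - T) *\<^sub>v ones d"
    by (simp add: c_plus_eq minus_mult_distrib_mat_vec[of _ d d])
  then have "R *\<^sub>v c_plus f M p0 p1 = (R * (1\<^sub>m d - T)) *\<^sub>v ones d"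
    using R by (subst assoc_mult_mat_vec[of _ d d _ d]) (auto intro: minus_carrier_mat)
  then show ?thesis
    by (simp add: R(3))
qed

text \<open>The series of \<open>T ^ n 1\<close>, i.e. the vector of mean delays by initial
  state.\<close>

definition w1 :: "real vec" where
  "w1 = R *\<^sub>v ones d"

text \<open>Second moments by initial state, modelled on the power series of
  \<open>(2 n + 1) x ^ n\<close>, whose sum is \<open>(1 + x) / (1 - x) ^ 2\<close>.\<close>

definition w2 :: "real vec" where
  "w2 = R *\<^sub>v w1 + T *\<^sub>v (R *\<^sub>v w1)"

lemma w_carrier [simp]: "w1 \<in> carrier_vec d" "w2 \<in> carrier_vec d"
  by (simp_all add: w1_def w2_def)

lemma c_plus_carrier [simp]: "c_plus f M p0 p1 \<in> carrier_vec d"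
  by (simp add: c_plus_eq)

lemma R_pow_c_plus:
  "R ^\<^sub>m 2 *\<^sub>v c_plus f M p0 p1 = w1"
  "(1\<^sub>m d + T) * R ^\<^sub>m 3 *\<^sub>v c_plus f M p0 p1 = w2"
proof -
  have [simp]: "R ^\<^sub>m n *\<^sub>v v \<in> carrier_vec d" if "v \<in> carrier_vec d" for n v
    using that by (intro mult_mat_vec_carrier[of _ d d] pow_carrier_mat R)
  show 2: "R ^\<^sub>m 2 *\<^sub>v c_plus f M p0 p1 = w1"
    unfolding numeral_2_eq_2 using R(1)
    by (simp only: pow_mat_mult_vec_Suc[OF R(1)] c_plus_carrier R_c_plus ones_carrier w1_def)
      (simp add: w1_def[symmetric])
  have "R ^\<^sub>m 3 *\<^sub>v c_plus f M p0 p1 = R *\<^sub>v w1"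
    unfolding 2[symmetric] numeral_3_eq_3 numeral_2_eq_2
    by (rule pow_mat_mult_vec_Suc'[OF R(1)]) simp
  then have "(1\<^sub>m d + T) * R ^\<^sub>m 3 *\<^sub>v c_plus f M p0 p1 = (1\<^sub>m d + T) *\<^sub>v (R *\<^sub>v w1)"
    by (subst assoc_mult_mat_vec[of _ d d _ d]) (auto intro: pow_carrier_mat R)
  also have "\<dots> = w2"
    by (subst add_mult_distrib_mat_vec[of _ d d]) (simp_all add: w2_def)
  finally show "(1\<^sub>m d + T) * R ^\<^sub>m 3 *\<^sub>v c_plus f M p0 p1 = w2" .
qed

lemma w1_minus: "w1 - T *\<^sub>v w1 = ones d"
  unfolding w1_def by (rule R_minus_T_R) simp

text \<open>Formally \<open>(I - T) (I + T) R w1 = (I + T) w1\<close>. Applying \<open>T\<close> to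
  \<open>R w1 - T R w1 = w1\<close> avoids having to commute \<open>R\<close> with
  \<open>T\<close>.\<close>

lemma w2_minus: "w2 - T *\<^sub>v w2 = w1 + T *\<^sub>v w1"
proof -
  let ?y = "R *\<^sub>v w1"
  have y: "?y \<in> carrier_vec d"
    by simp
  have "T *\<^sub>v w1 = T *\<^sub>v (?y - T *\<^sub>v ?y)"
    by (simp add: R_minus_T_R)
  also have "\<dots> = T *\<^sub>v ?y - T *\<^sub>v (T *\<^sub>v ?y)"
    by (rule mult_minus_distrib_mat_vec[of _ d d]) simp_all
  finally have Tw1: "T *\<^sub>v w1 = T *\<^sub>v ?y - T *\<^sub>v (T *\<^sub>v ?y)" .
  have "T *\<^sub>v w2 = T *\<^sub>v ?y + T *\<^sub>v (T *\<^sub>v ?y)"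
    unfolding w2_def by (rule mult_add_distrib_mat_vec[of _ d d]) simp_all
  moreover have "w1 = ?y - T *\<^sub>v ?y"
    by (simp add: R_minus_T_R)
  ultimately have "w2 - T *\<^sub>v w2 = (?y + T *\<^sub>v ?y) - (T *\<^sub>v ?y + T *\<^sub>v (T *\<^sub>v ?y))"
    "w1 + T *\<^sub>v w1 = (?y - T *\<^sub>v ?y) + (T *\<^sub>v ?y - T *\<^sub>v (T *\<^sub>v ?y))"
    by (simp_all only: w2_def[symmetric] Tw1[symmetric])
  then show ?thesis
    using carrier_vecD[OF y] carrier_vecD[OF T_mult_vec[OF y]]
      carrier_vecD[OF T_mult_vec[OF T_mult_vec[OF y]]]
    by auto
qed

section \<open>Summation of the tails by telescoping\<close>

context
  fixes pv :: "real vec"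
  assumes pv: "pv \<in> carrier_vec d"
begin

lemma scalar_T_pow_minus:
  assumes "w \<in> carrier_vec d"
  shows "pv \<bullet> (T ^\<^sub>m n *\<^sub>v w) - pv \<bullet> (T ^\<^sub>m Suc n *\<^sub>v w) = pv \<bullet> (T ^\<^sub>m n *\<^sub>v (w - T *\<^sub>v w))"
  unfolding pow_mat_mult_vec_Suc[OF T_carrier assms]
  using assms pv
  by (simp add: mult_minus_distrib_mat_vec[of _ d d] scalar_prod_minus_distrib[of _ d])

text \<open>These are the boundary terms of the telescoping sums; the factor n appears in the one
  for the second moment and is absorbed by the geometric decay.\<close>

lemma times_scalar_T_pow_tendsto_0:
  assumes "w \<in> carrier_vec d"
  shows "(\<lambda>n. real n * (pv \<bullet> (T ^\<^sub>m n *\<^sub>v w))) \<longlonglongrightarrow> 0" "(\<lambda>n. pv \<bullet> (T ^\<^sub>m n *\<^sub>v w)) \<longlonglongrightarrow> 0"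
proof -
  obtain r C where r: "0 < r" "r < 1" "0 \<le> C" "\<And>n i. i < d \<Longrightarrow> \<bar>(T ^\<^sub>m n *\<^sub>v w) $ i\<bar> \<le> C * r ^ n"
    using T_pow_geometric[OF assms] by metis
  define B where "B = (\<Sum>i<d. \<bar>pv $ i\<bar>) * C"
  have bound: "\<bar>pv \<bullet> (T ^\<^sub>m n *\<^sub>v w)\<bar> \<le> B * r ^ n" for n
  proof -
    have "dim_vec (T ^\<^sub>m n *\<^sub>v w) = d"
      using assms by (intro carrier_vecD) simp
    then have "\<bar>pv \<bullet> (T ^\<^sub>m n *\<^sub>v w)\<bar> = \<bar>\<Sum>i<d. pv $ i * (T ^\<^sub>m n *\<^sub>v w) $ i\<bar>"
      by (simp only: scalar_prod_def atLeast0LessThan)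
    also have "\<dots> \<le> (\<Sum>i<d. \<bar>pv $ i\<bar> * \<bar>(T ^\<^sub>m n *\<^sub>v w) $ i\<bar>)"
      by (simp only: abs_mult[symmetric]) (rule sum_abs)
    also have "\<dots> \<le> (\<Sum>i<d. \<bar>pv $ i\<bar> * (C * r ^ n))"
      using r by (intro sum_mono mult_left_mono) auto
    also have "\<dots> = B * r ^ n"
      by (simp add: B_def sum_distrib_right[symmetric] mult.assoc)
    finally show ?thesis .
  qed
  have nr: "(\<lambda>n. real n * r ^ n) \<longlonglongrightarrow> 0"
    using r by (intro powser_times_n_limit_0) simp
  have lim: "(\<lambda>n. B * (real n * r ^ n)) \<longlonglongrightarrow> 0" "(\<lambda>n. B * r ^ n) \<longlonglongrightarrow> 0"
    using tendsto_mult[OF tendsto_const[of B] nr]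
      tendsto_mult[OF tendsto_const[of B] LIMSEQ_power_zero[of r]] r by auto
  have "\<bar>real n * (pv \<bullet> (T ^\<^sub>m n *\<^sub>v w))\<bar> \<le> B * (real n * r ^ n)" for n
    using mult_left_mono[OF bound[of n], of "real n"] by (simp add: abs_mult ac_simps)
  then show "(\<lambda>n. real n * (pv \<bullet> (T ^\<^sub>m n *\<^sub>v w))) \<longlonglongrightarrow> 0"
    by (intro tendsto_rabs_zero_cancel[OF tendsto_sandwich[OF _ _ tendsto_const lim(1)]]) auto
  show "(\<lambda>n. pv \<bullet> (T ^\<^sub>m n *\<^sub>v w)) \<longlonglongrightarrow> 0"
    using bound by (intro tendsto_rabs_zero_cancel[OF tendsto_sandwich[OF _ _ tendsto_const lim(2)]]) auto
qed

lemma tails_sums: "(\<lambda>n. pv \<bullet> (T ^\<^sub>m n *\<^sub>v ones d)) sums (pv \<bullet> w1)"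
  using telescope_sums'[OF times_scalar_T_pow_tendsto_0(2)[of w1]]
  by (simp only: scalar_T_pow_minus w_carrier w1_minus) simp

text \<open>Telescoping: with \<open>a\<^sub>n\<close>, \<open>b\<^sub>n\<close> the products of \<open>pv\<close> with \<open>T\<^sup>n w1\<close>, \<open>T\<^sup>n w2\<close>,
  the summand is the difference of consecutive values of \<open>2 n a\<^sub>n + b\<^sub>n\<close>.\<close>

lemma weighted_tails_sums:
  "(\<lambda>n. (2 * real n + 1) * (pv \<bullet> (T ^\<^sub>m n *\<^sub>v ones d))) sums (pv \<bullet> w2)"
proof -
  define a where "a n = pv \<bullet> (T ^\<^sub>m n *\<^sub>v w1)" for n
  define b where "b n = pv \<bullet> (T ^\<^sub>m n *\<^sub>v w2)" for n
  have a: "a n - a (Suc n) = pv \<bullet> (T ^\<^sub>m n *\<^sub>v ones d)" for n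
    unfolding a_def by (simp only: scalar_T_pow_minus w_carrier w1_minus)
  have "b n - b (Suc n) = pv \<bullet> (T ^\<^sub>m n *\<^sub>v (w1 + T *\<^sub>v w1))" for n
    unfolding b_def by (simp only: scalar_T_pow_minus w_carrier w2_minus)
  also have "pv \<bullet> (T ^\<^sub>m n *\<^sub>v (w1 + T *\<^sub>v w1)) = a n + a (Suc n)" for n
    unfolding a_def pow_mat_mult_vec_Suc[OF T_carrier w_carrier(1)]
    using pv by (simp add: mult_add_distrib_mat_vec[of _ d d] scalar_prod_add_distrib[of _ d])
  finally have b: "b n - b (Suc n) = a n + a (Suc n)" for n .
  have "(\<lambda>n. 2 * (real n * a n) + b n) \<longlonglongrightarrow> 2 * 0 + 0"
    unfolding a_def b_def by (intro tendsto_intros times_scalar_T_pow_tendsto_0) simp_all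
  then have "(\<lambda>n. 2 * (real n * a n) + b n - (2 * (real (Suc n) * a (Suc n)) + b (Suc n)))
      sums (2 * (real 0 * a 0) + b 0 - (2 * 0 + 0))"
    by (rule telescope_sums')
  moreover have "2 * (real n * a n) + b n - (2 * (real (Suc n) * a (Suc n)) + b (Suc n))
      = (2 * real n + 1) * (pv \<bullet> (T ^\<^sub>m n *\<^sub>v ones d))" for n
    using b[of n] unfolding a[symmetric] by (simp add: algebra_simps)
  moreover have "b 0 = pv \<bullet> w2"
    using T_carrier w_carrier by (simp add: b_def del: T_carrier)
  ultimately show ?thesis
    by simp
qed

end

end

section \<open>The source delay in matrix form\<close>

context pd_queue_from
begin

definition \<pi> :: "real vec" where
  "\<pi> = delete_first (cond_steady_vec f M p0 p1 lam init)"

lemma \<pi>_carrier: "\<pi> \<in> carrier_vec d"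
  by (simp add: \<pi>_def delete_first_def cond_steady_vec_def)

text \<open>Deleting the entry of the empty state shifts the enumeration by one, which cancels the
  \<open>k - 1\<close> in \<open>state_at\<close>.\<close>

lemma \<pi>_index: "i < d \<Longrightarrow> \<pi> $ i = steady (i div f + 1, i mod f)"
  by (simp add: \<pi>_def delete_first_def cond_steady_vec_def state_at_def)

lemma bij_betw_index: "bij_betw (\<lambda>i. (i div f + 1, i mod f)) {..<d} busy"
proof (rule bij_betw_byWitness[where f' = "\<lambda>(k, j). (k - 1) * f + j"])
  show "(\<lambda>i. (i div f + 1, i mod f)) ` {..<d} \<subseteq> busy"
    using f by (auto simp: busy_def Suc_le_eq less_mult_imp_div_less)
  show "(\<lambda>(k, j). (k - 1) * f + j) ` busy \<subseteq> {..<d}"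
  proof clarify
    fix k j assume "(k, j) \<in> busy"
    then have "k \<ge> 1" "k \<le> M" "j < f"
      by (auto simp: busy_def)
    then have "(k - 1) * f + j < (k - 1) * f + f"
      by simp
    also have "\<dots> = k * f"
      using \<open>k \<ge> 1\<close> by (cases k) simp_all
    also have "\<dots> \<le> d"
      using \<open>k \<le> M\<close> by simp
    finally show "(k - 1) * f + j < d" .
  qed
qed (auto simp: busy_def)

lemma delay_tail_eq: "delay_tail u = \<pi> \<bullet> (T ^\<^sub>m u *\<^sub>v ones d)"
proof -
  have "delay_tail u = (\<Sum>i<d. steady (i div f + 1, i mod f) * tail u (i div f + 1) (i mod f))"
    unfolding delay_tail_def
    by (subst sum.reindex_bij_betw[OF bij_betw_index, symmetric]) simp
  also have "\<dots> = (\<Sum>i<d. \<pi> $ i * (T ^\<^sub>m u *\<^sub>v ones d) $ i)"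
    by (intro sum.cong refl) (simp add: \<pi>_index T_pow_ones del: index_mult_mat_vec)
  also have "\<dots> = \<pi> \<bullet> (T ^\<^sub>m u *\<^sub>v ones d)"
    using carrier_vecD[OF T_pow_mult_vec[OF ones_carrier, of u]]
    by (simp only: scalar_prod_def atLeast0LessThan)
  finally show ?thesis .
qed

lemma delay_moments:
  "has_bochner_integral tagged (\<lambda>\<omega>. real (source_delay f M \<omega>)) (\<pi> \<bullet> w1)"
  "has_bochner_integral tagged (\<lambda>\<omega>. (real (source_delay f M \<omega>))\<^sup>2) (\<pi> \<bullet> w2)"
proof -
  interpret prob_space tagged by (rule prob_space_tagged)
  have 1: "(\<Sum>u<n. 1 :: real) = real n" for n
    by simp
  \<comment> \<open>The first n odd numbers add up to the square of n, whence the weights of the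
    second moment.\<close>
  have 2: "(\<Sum>u<n. 2 * real u + 1) = (real n)\<^sup>2" for n
    by (induction n) (simp_all add: power2_eq_square algebra_simps)
  show "has_bochner_integral tagged (\<lambda>\<omega>. real (source_delay f M \<omega>)) (\<pi> \<bullet> w1)"
    using moments_from_tails[of "source_delay f M" "\<lambda>_. 1" "\<pi> \<bullet> w1"] tails_sums[OF \<pi>_carrier]
    unfolding 1 by (simp add: prob_source_delay_gt delay_tail_eq)
  show "has_bochner_integral tagged (\<lambda>\<omega>. (real (source_delay f M \<omega>))\<^sup>2) (\<pi> \<bullet> w2)"
    using moments_from_tails[of "source_delay f M" "\<lambda>u. 2 * real u + 1" "\<pi> \<bullet> w2"]
      weighted_tails_sums[OF \<pi>_carrier]
    unfolding 2 by (simp add: prob_source_delay_gt delay_tail_eq)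
qed

lemma delay_pmf:
  assumes "u \<ge> 1"
  shows "measure tagged {\<omega>. source_delay f M \<omega> = u} = \<pi> \<bullet> (T ^\<^sub>m (u - 1) *\<^sub>v c_plus f M p0 p1)"
  using scalar_T_pow_minus[OF \<pi>_carrier ones_carrier, of "u - 1"] assms
  by (simp add: prob_source_delay_eq delay_tail_eq c_plus_eq)

end

text \<open>Convergence, invertibility and integrability are asserted along with the formulas,
  because \<open>lim\<close>, \<open>the\<close> and the integral are total and would otherwise
  allow meaningless default values.\<close>

theorem theorem1:
  fixes n m f M :: nat
    and \<Delta> q lam p0 p1 p2 :: real
    and init :: "state pmf"
    and pi_minus c :: "real vec"
    and T I R :: "real mat"
    and P :: "sample measure"
    and U :: "sample \<Rightarrow> nat"
  assumes "n \<ge> 2" and "m \<ge> 3" and "\<Delta> \<ge> 0"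
    and "f \<ge> 1" and "M \<ge> 1" and "0 < q" and "q < 1" and "0 < lam" and "lam < 1"
    and "p0 = sd_prob n m \<Delta>" and "p1 = pd_prob n m \<Delta> q" and "p2 = 1 - p0 - p1"
    and "set_pmf init \<subseteq> states f M"
    and "P = tagged_space f M p0 p1 lam init" and "U = source_delay f M"
    and "pi_minus = delete_first (cond_steady_vec f M p0 p1 lam init)"
    and "T = T_mat f M p0 p1 p2" and "c = c_plus f M p0 p1"
    and "I = 1\<^sub>m (M * f)" and "R = the (mat_inverse (I - T))"
  shows "(\<forall>s. convergent (\<lambda>t. cond_dist f M p0 p1 lam init t s)) \<and>
         invertible_mat (I - T) \<and>
         (\<forall>u\<ge>1. measure P {\<omega> \<in> space P. U \<omega> = u} = pi_minus \<bullet> (T ^\<^sub>m (u - 1) *\<^sub>v c)) \<and>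
         (\<forall>u. measure P {\<omega> \<in> space P. U \<omega> \<le> u} = 1 - pi_minus \<bullet> (T ^\<^sub>m u *\<^sub>v ones (M * f))) \<and>
         integrable P (\<lambda>\<omega>. real (U \<omega>)) \<and>
         integrable P (\<lambda>\<omega>. (real (U \<omega>))\<^sup>2) \<and>
         prob_space.expectation P (\<lambda>\<omega>. real (U \<omega>)) = pi_minus \<bullet> (R ^\<^sub>m 2 *\<^sub>v c) \<and>
         prob_space.variance P (\<lambda>\<omega>. real (U \<omega>))
           = pi_minus \<bullet> ((I + T) * R ^\<^sub>m 3 *\<^sub>v c)
             - (prob_space.expectation P (\<lambda>\<omega>. real (U \<omega>)))\<^sup>2"
proof -
  have bounds: "0 < p0" "0 \<le> p1" "p0 + p1 < 1"
    using slot_prob_bounds[of n m \<Delta> q] assms by auto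
  interpret Q: pd_queue_from f M p0 p1 lam init
    using assms bounds by unfold_locales auto
  interpret prob_space P
    unfolding \<open>P = _\<close> by (rule Q.prob_space_tagged)
  have T: "T = Q.T"
    using \<open>T = _\<close> unfolding \<open>p2 = _\<close> .
  have R: "R = Q.R"
    using \<open>R = _\<close> unfolding Q.R_def T \<open>I = _\<close> .
  have pi: "pi_minus = Q.\<pi>"
    unfolding Q.\<pi>_def by fact
  note eqs = \<open>P = _\<close> \<open>U = _\<close> pi T \<open>c = _\<close> \<open>I = _\<close> R
  have 1: "integrable P (\<lambda>\<omega>. real (U \<omega>))" "expectation (\<lambda>\<omega>. real (U \<omega>)) = pi_minus \<bullet> Q.w1"
    using Q.delay_moments(1) by (simp_all add: eqs has_bochner_integral_iff)
  have 2: "integrable P (\<lambda>\<omega>. (real (U \<omega>))\<^sup>2)"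
    "expectation (\<lambda>\<omega>. (real (U \<omega>))\<^sup>2) = pi_minus \<bullet> Q.w2"
    using Q.delay_moments(2) by (simp_all add: eqs has_bochner_integral_iff)
  have "\<forall>s. convergent (\<lambda>t. cond_dist f M p0 p1 lam init t s)"
    using Q.convergent_cond_dist by blast
  moreover have "invertible_mat (I - T)"
    unfolding eqs by (rule Q.invertible_mat_one_minus_T)
  moreover have "\<forall>u\<ge>1. measure P {\<omega> \<in> space P. U \<omega> = u} = pi_minus \<bullet> (T ^\<^sub>m (u - 1) *\<^sub>v c)"
    unfolding eqs using Q.delay_pmf by simp
  moreover have "\<forall>u. measure P {\<omega> \<in> space P. U \<omega> \<le> u} = 1 - pi_minus \<bullet> (T ^\<^sub>m u *\<^sub>v ones (M * f))"
    unfolding eqs using Q.prob_source_delay_le by (simp add: Q.delay_tail_eq)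
  moreover have "expectation (\<lambda>\<omega>. real (U \<omega>)) = pi_minus \<bullet> (R ^\<^sub>m 2 *\<^sub>v c)"
    unfolding 1(2) unfolding eqs Q.R_pow_c_plus ..
  moreover have "variance (\<lambda>\<omega>. real (U \<omega>)) =
      pi_minus \<bullet> ((I + T) * R ^\<^sub>m 3 *\<^sub>v c) - (expectation (\<lambda>\<omega>. real (U \<omega>)))\<^sup>2"
    unfolding variance_eq[OF 1(1) 2(1)] 2(2) unfolding eqs Q.R_pow_c_plus ..
  ultimately show ?thesis
    using 1(1) 2(1) by blast
qed

end
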